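(* Let $G=(V,E)$ be a block-cactus of order at least $2$. Then $\lambda(\overline G)=\lambda(G)+1$ if and only if $G$ is isomorphic to one of the following graphs: (a) $K_1\vee(K_1+K_r)$ with $r\ge 2$; (b) the graph obtained by joining (by an edge) one vertex of $K_2$ with a vertex of a complete graph of order $r+1$, with $r\ge 2$; (c) $K_{r+1}$ with $r\ge 1$; (d) $K_1\vee(K_{r_1}+\dots+K_{r_t})$ with $t\ge 2$ and $r_1,\dots,r_t\ge 2$.
   Context: All graphs are finite and simple. $N_G(v)$ is the open neighborhood of $v$ in $G$ and $\overline G$ is the complement of $G$. $G+H$ denotes the disjoint union of two graphs and $G\vee H$ their join (the disjoint union together with all edges between $V(G)$ and $V(H)$). A set $S\subseteq V(G)$ is dominating if every $v\in V(G)\setminus S$ has $N_G(v)\cap S\neq\emptyset$. An LD-set (locating-dominating set) of $G$ is a dominating set $S$ such that $N_G(u)\cap S\ne N_G(v)\cap S$ for every two different vertices $u,v\in V(G)\setminus S$. The location-domination number $\lambda(G)$ is the minimum cardinality of an LD-set of $G$. A block of a graph is a maximal connected subgraph with no cut vertices (of its own). A block-cactus is a connected graph each of whose blocks is either a cycle or a complete graph. *)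

theory Defs
  imports "Graph_Theory.Digraph_Isomorphism" "Graph_Theory.Kuratowski"
begin

text \<open>
  Finite simple graphs are symmetric loopless finite digraphs without parallel arcs
  (locale \<^locale>\<open>pair_graph\<close> of the entry Graph Theory); an undirected edge is the pair of arcs
  \<open>(u, v)\<close> and \<open>(v, u)\<close>.
\<close>

subsection \<open>Location-domination\<close>

definition neighborhood :: "'a pair_pre_digraph \<Rightarrow> 'a \<Rightarrow> 'a set" where
  "neighborhood G v = {u. (v, u) \<in> parcs G}"

definition complement :: "'a pair_pre_digraph \<Rightarrow> 'a pair_pre_digraph" where
  "complement G = \<lparr>pverts = pverts G,
     parcs = {(u, v). u \<in> pverts G \<and> v \<in> pverts G \<and> u \<noteq> v \<and> (u, v) \<notin> parcs G}\<rparr>"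

definition dominating_set :: "'a pair_pre_digraph \<Rightarrow> 'a set \<Rightarrow> bool" where
  "dominating_set G S \<longleftrightarrow>
     S \<subseteq> pverts G \<and> (\<forall>v \<in> pverts G - S. neighborhood G v \<inter> S \<noteq> {})"

definition LD_set :: "'a pair_pre_digraph \<Rightarrow> 'a set \<Rightarrow> bool" where
  "LD_set G S \<longleftrightarrow> dominating_set G S \<and>
     (\<forall>u \<in> pverts G - S. \<forall>v \<in> pverts G - S.
        u \<noteq> v \<longrightarrow> neighborhood G u \<inter> S \<noteq> neighborhood G v \<inter> S)"

definition location_domination_number :: "'a pair_pre_digraph \<Rightarrow> nat" where
  "location_domination_number G = Min (card ` {S. LD_set G S})"

subsection \<open>Block-cactus graphs\<close>

text \<open>A cut vertex separates two other vertices of the same component.\<close>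

definition cut_vertex :: "('a, 'b) pre_digraph \<Rightarrow> 'a \<Rightarrow> bool" where
  "cut_vertex G v \<longleftrightarrow> v \<in> verts G \<and>
     (\<exists>u \<in> verts G - {v}. \<exists>w \<in> verts G - {v}.
        u \<rightarrow>\<^sup>*\<^bsub>G\<^esub> w \<and> \<not> u \<rightarrow>\<^sup>*\<^bsub>pre_digraph.del_vert G v\<^esub> w)"

text \<open>
  The conjunct \<open>graph H\<close> restricts the maximality to undirected subgraphs:
  \<^const>\<open>pre_digraph.max_subgraph\<close> alone ranges over all subdigraphs.
\<close>

definition block :: "('a, 'b) pre_digraph \<Rightarrow> ('a, 'b) pre_digraph \<Rightarrow> bool" where
  "block G = pre_digraph.max_subgraph G
     (\<lambda>H. graph H \<and> connected H \<and> (\<nexists>v. cut_vertex H v))"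

definition cycle_graph :: "nat \<Rightarrow> nat pair_pre_digraph" where
  "cycle_graph n = \<lparr>pverts = {..<n},
     parcs = {(i, j). i < n \<and> j < n \<and> (j = (i + 1) mod n \<or> i = (j + 1) mod n)}\<rparr>"

definition is_cycle :: "('a, 'b) pre_digraph \<Rightarrow> bool" where
  "is_cycle H \<longleftrightarrow> (\<exists>n \<ge> 3. digraph_iso H (with_proj (cycle_graph n)))"

definition block_cactus :: "'a pair_pre_digraph \<Rightarrow> bool" where
  "block_cactus G \<longleftrightarrow> connected (with_proj G) \<and>
     (\<forall>H. block (with_proj G) H \<longrightarrow> is_cycle H \<or> (\<exists>n. K\<^bsub>n\<^esub> H))"

subsection \<open>Constructions\<close>

definition complete_graph :: "nat \<Rightarrow> nat pair_pre_digraph" where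
  "complete_graph n = \<lparr>pverts = {..<n}, parcs = {(i, j). i < n \<and> j < n \<and> i \<noteq> j}\<rparr>"

definition disjoint_union ::
    "'a pair_pre_digraph \<Rightarrow> 'b pair_pre_digraph \<Rightarrow> ('a + 'b) pair_pre_digraph" where
  "disjoint_union G H = \<lparr>pverts = pverts G <+> pverts H,
     parcs = {(Inl u, Inl v) |u v. (u, v) \<in> parcs G} \<union> {(Inr u, Inr v) |u v. (u, v) \<in> parcs H}\<rparr>"

definition indexed_disjoint_union ::
    "'i set \<Rightarrow> ('i \<Rightarrow> 'a pair_pre_digraph) \<Rightarrow> ('i \<times> 'a) pair_pre_digraph" where
  "indexed_disjoint_union I G = \<lparr>pverts = Sigma I (\<lambda>i. pverts (G i)),
     parcs = {((i, u), (i, v)) |i u v. i \<in> I \<and> (u, v) \<in> parcs (G i)}\<rparr>"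

definition graph_join ::
    "'a pair_pre_digraph \<Rightarrow> 'b pair_pre_digraph \<Rightarrow> ('a + 'b) pair_pre_digraph" where
  "graph_join G H = \<lparr>pverts = pverts (disjoint_union G H),
     parcs = parcs (disjoint_union G H)
       \<union> Inl ` pverts G \<times> Inr ` pverts H \<union> Inr ` pverts H \<times> Inl ` pverts G\<rparr>"

definition join_by_edge ::
    "'a pair_pre_digraph \<Rightarrow> 'a \<Rightarrow> 'b pair_pre_digraph \<Rightarrow> 'b \<Rightarrow> ('a + 'b) pair_pre_digraph" where
  "join_by_edge G u H v = \<lparr>pverts = pverts (disjoint_union G H),
     parcs = parcs (disjoint_union G H) \<union> {(Inl u, Inr v), (Inr v, Inl u)}\<rparr>"

definition isomorphic :: "'a pair_pre_digraph \<Rightarrow> 'b pair_pre_digraph \<Rightarrow> bool" where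
  "isomorphic G H \<longleftrightarrow> digraph_iso (with_proj G) (with_proj H)"

end

theory Submission
  imports Defs
begin

text \<open>
  Let \<open>S\<close> be an LD-set of \<open>G\<close> and call \<open>N v \<inter> S\<close> the trace of an outside vertex \<open>v\<close>. In the
  complement the trace of \<open>v\<close> is the rest of \<open>S\<close>, so distinct traces stay distinct, and \<open>S\<close> can
  fail in the complement only because some outside vertex \<open>w\<close> is adjacent to all of \<open>S\<close>. There is at
  most one such \<open>w\<close>, and adding it to \<open>S\<close> repairs the failure. Hence the number of the complement
  exceeds that of \<open>G\<close> by at most one, and if it does exceed it, then a minimum \<open>S\<close> lies in \<open>N w\<close> for
  an outside \<open>w\<close>, and no exchange of vertices may turn \<open>S\<close> into an LD-set of the complement of the
  same size. The structure of \<open>G\<close> comes from these forbidden exchanges.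

  The block-cactus hypothesis enters only through \<open>biconnected_set_clique\<close>: a set that no vertex
  separates, and in which some vertex has three neighbors, is a clique. Applied to unions of
  triangles, 4-cycles and 5-cycles it shows that \<open>N w\<close> induces a disjoint union of cliques and that
  nothing can be attached at two vertices to a chordless 4-cycle or 5-cycle through \<open>w\<close>. The outside
  vertices other than \<open>w\<close> split into \<open>X\<close>, the neighbors of \<open>w\<close>, and \<open>Z\<close>, at distance two. A vertex of
  \<open>X\<close> has as its trace the part in \<open>S\<close> of its clique of \<open>N w\<close>. Exchanges show that every vertex of \<open>Z\<close>
  is a pendant vertex at a vertex of \<open>S\<close> (\<open>trace_Z_singleton\<close>, \<open>Z_independent\<close>) and that the clique it
  hangs on contains no vertex of \<open>X\<close> (\<open>no_pendant_beside_X\<close>); and if a clique of \<open>N w\<close> has no vertex in \<open>X\<close>, then trading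
  one of its vertices for \<open>w\<close> must leave a vertex undominated in the complement, which means that
  \<open>N w\<close> has one clique, or two of which one meets \<open>S\<close> in a single vertex (\<open>exchange_center\<close>). Either
  every clique of \<open>N w\<close> meets \<open>X\<close>, and \<open>G\<close> consists of at least two cliques glued at \<open>w\<close>; or
  one of the two small configurations remains, which yields the complete graphs, the cliques with a
  pendant vertex and the cliques with a pendant path of length two (\<open>extremal_structure\<close>).

  Conversely, in each family an LD-set of the complement can be replaced by a smaller LD-set of \<open>G\<close>,
  mostly because a vertex adjacent to all others is isolated in the complement and must be paid for
  there.
\<close>

section \<open>Sets of vertices that no vertex separates\<close>

definition induced_edges :: "'a pair_pre_digraph \<Rightarrow> 'a set \<Rightarrow> 'a rel" where
  "induced_edges G U = parcs G \<inter> U \<times> U"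

definition connected_set :: "'a pair_pre_digraph \<Rightarrow> 'a set \<Rightarrow> bool" where
  "connected_set G U \<longleftrightarrow> (\<forall>u\<in>U. \<forall>v\<in>U. (u, v) \<in> (induced_edges G U)\<^sup>*)"

text \<open>Connectedness of \<open>U\<close> itself is a separate conjunct because \<open>U\<close> may contain every element of the type,
  and then no \<open>v\<close> lies outside \<open>U\<close>.\<close>

definition biconnected_set :: "'a pair_pre_digraph \<Rightarrow> 'a set \<Rightarrow> bool" where
  "biconnected_set G U \<longleftrightarrow> connected_set G U \<and> (\<forall>v. connected_set G (U - {v}))"

lemma induced_edges_mono: "U \<subseteq> W \<Longrightarrow> induced_edges G U \<subseteq> induced_edges G W"
  by (auto simp: induced_edges_def)

lemma connected_set_Un:
  assumes "connected_set G A" "connected_set G B" "A \<inter> B \<noteq> {}"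
  shows "connected_set G (A \<union> B)"
proof -
  obtain c where c: "c \<in> A" "c \<in> B" using assms(3) by auto
  have A: "(u, v) \<in> (induced_edges G (A \<union> B))\<^sup>*" if "u \<in> A" "v \<in> A" for u v
    using assms(1) that rtrancl_mono[OF induced_edges_mono[of A "A \<union> B" G]]
    by (auto simp: connected_set_def)
  have B: "(u, v) \<in> (induced_edges G (A \<union> B))\<^sup>*" if "u \<in> B" "v \<in> B" for u v
    using assms(2) that rtrancl_mono[OF induced_edges_mono[of B "A \<union> B" G]]
    by (auto simp: connected_set_def)
  show ?thesis unfolding connected_set_def
    using A B c by (blast intro: rtrancl_trans)
qed

text \<open>When one vertex is deleted, the other common vertex still links the two parts.\<close>

lemma biconnected_set_Un:
  assumes "biconnected_set G A" "biconnected_set G B" "x \<in> A \<inter> B" "y \<in> A \<inter> B" "x \<noteq> y"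
  shows "biconnected_set G (A \<union> B)"
proof -
  have "connected_set G (A \<union> B - {v})" for v
  proof -
    have "(A - {v}) \<inter> (B - {v}) \<noteq> {}" using assms(3-5) by auto
    with assms(1,2) have "connected_set G ((A - {v}) \<union> (B - {v}))"
      by (auto simp: biconnected_set_def intro: connected_set_Un)
    then show ?thesis by (simp add: Un_Diff)
  qed
  moreover have "connected_set G (A \<union> B)"
    using assms by (auto simp: biconnected_set_def intro!: connected_set_Un)
  ultimately show ?thesis by (simp add: biconnected_set_def)
qed

lemma biconnected_setI:
  assumes "finite U" "connected_set G U" "\<And>v. v \<in> U \<Longrightarrow> connected_set G (U - {v})"
  shows "biconnected_set G U"
  using assms unfolding biconnected_set_def by (metis Diff_empty Diff_insert0)

context pair_graph
begin

lemma adj_sym: "(u, v) \<in> parcs G \<Longrightarrow> (v, u) \<in> parcs G"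
  using pair_sym_arcs by (auto simp: symmetric_def dest: symD)

lemma adj_irrefl [simp]: "(u, u) \<notin> parcs G"
  using pair_no_loops by fastforce

lemma connected_set_path:
  "successively (\<lambda>u v. (u, v) \<in> parcs G) xs \<Longrightarrow> connected_set G (set xs)"
proof (induction xs rule: induct_list012)
  case 1
  then show ?case by (simp add: connected_set_def)
next
  case (2 x)
  then show ?case by (simp add: connected_set_def)
next
  case (3 x y zs)
  have "connected_set G {x, y}"
    using 3(3) adj_sym[of x y]
    by (auto simp: connected_set_def induced_edges_def intro!: r_into_rtrancl)
  moreover have "connected_set G (set (y # zs))" using 3 by simp
  ultimately have "connected_set G ({x, y} \<union> set (y # zs))"
    by (rule connected_set_Un) auto
  then show ?case by (simp add: insert_commute)
qed

text \<open>Deleting a vertex of a cycle leaves a path.\<close>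

lemma biconnected_set_triangle:
  assumes "(a, b) \<in> parcs G" "(b, c) \<in> parcs G" "(c, a) \<in> parcs G"
  shows "biconnected_set G {a, b, c}"
proof (rule biconnected_setI)
  have dist: "distinct [a, b, c]" using assms by auto
  show "connected_set G {a, b, c}" using connected_set_path[of "[a, b, c]"] assms by simp
  fix v assume "v \<in> {a, b, c}"
  then consider "v = a" | "v = b" | "v = c" by auto
  then show "connected_set G ({a, b, c} - {v})"
  proof cases
    case 1
    then have "{a, b, c} - {v} = set [b, c]" using dist by auto
    then show ?thesis using connected_set_path[of "[b, c]"] assms by simp
  next
    case 2
    then have "{a, b, c} - {v} = set [c, a]" using dist by auto
    then show ?thesis using connected_set_path[of "[c, a]"] assms by simp
  next
    case 3
    then have "{a, b, c} - {v} = set [a, b]" using dist by auto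
    then show ?thesis using connected_set_path[of "[a, b]"] assms by simp
  qed
qed simp

lemma biconnected_set_cycle4:
  assumes "(a, b) \<in> parcs G" "(b, c) \<in> parcs G" "(c, d) \<in> parcs G" "(d, a) \<in> parcs G"
    and "a \<noteq> c" "b \<noteq> d"
  shows "biconnected_set G {a, b, c, d}"
proof (rule biconnected_setI)
  have dist: "distinct [a, b, c, d]" using assms by auto
  show "connected_set G {a, b, c, d}" using connected_set_path[of "[a, b, c, d]"] assms by simp
  fix v assume "v \<in> {a, b, c, d}"
  then consider "v = a" | "v = b" | "v = c" | "v = d" by auto
  then show "connected_set G ({a, b, c, d} - {v})"
  proof cases
    case 1
    then have "{a, b, c, d} - {v} = set [b, c, d]" using dist by auto
    then show ?thesis using connected_set_path[of "[b, c, d]"] assms by simp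
  next
    case 2
    then have "{a, b, c, d} - {v} = set [c, d, a]" using dist by auto
    then show ?thesis using connected_set_path[of "[c, d, a]"] assms by simp
  next
    case 3
    then have "{a, b, c, d} - {v} = set [d, a, b]" using dist by auto
    then show ?thesis using connected_set_path[of "[d, a, b]"] assms by simp
  next
    case 4
    then have "{a, b, c, d} - {v} = set [a, b, c]" using dist by auto
    then show ?thesis using connected_set_path[of "[a, b, c]"] assms by simp
  qed
qed simp

lemma biconnected_set_cycle5:
  assumes "(a, b) \<in> parcs G" "(b, c) \<in> parcs G" "(c, d) \<in> parcs G" "(d, e) \<in> parcs G" "(e, a) \<in> parcs G"
    and "distinct [a, b, c, d, e]"
  shows "biconnected_set G {a, b, c, d, e}"
proof (rule biconnected_setI)
  have dist: "distinct [a, b, c, d, e]" using assms by auto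
  show "connected_set G {a, b, c, d, e}" using connected_set_path[of "[a, b, c, d, e]"] assms by simp
  fix v assume "v \<in> {a, b, c, d, e}"
  then consider "v = a" | "v = b" | "v = c" | "v = d" | "v = e" by auto
  then show "connected_set G ({a, b, c, d, e} - {v})"
  proof cases
    case 1
    then have "{a, b, c, d, e} - {v} = set [b, c, d, e]" using dist by auto
    then show ?thesis using connected_set_path[of "[b, c, d, e]"] assms by simp
  next
    case 2
    then have "{a, b, c, d, e} - {v} = set [c, d, e, a]" using dist by auto
    then show ?thesis using connected_set_path[of "[c, d, e, a]"] assms by simp
  next
    case 3
    then have "{a, b, c, d, e} - {v} = set [d, e, a, b]" using dist by auto
    then show ?thesis using connected_set_path[of "[d, e, a, b]"] assms by simp
  next
    case 4
    then have "{a, b, c, d, e} - {v} = set [e, a, b, c]" using dist by auto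
    then show ?thesis using connected_set_path[of "[e, a, b, c]"] assms by simp
  next
    case 5
    then have "{a, b, c, d, e} - {v} = set [a, b, c, d]" using dist by auto
    then show ?thesis using connected_set_path[of "[a, b, c, d]"] assms by simp
  qed
qed simp

end

section \<open>Biconnected sets in a block-cactus\<close>

definition induced_graph :: "'a pair_pre_digraph \<Rightarrow> 'a set \<Rightarrow> 'a pair_pre_digraph" where
  "induced_graph G U = \<lparr>pverts = U, parcs = induced_edges G U\<rparr>"

lemma (in pair_graph) pair_graph_induced_graph:
  assumes "U \<subseteq> pverts G"
  shows "pair_graph (induced_graph G U)"
proof
  show "finite (pverts (induced_graph G U))" "finite (parcs (induced_graph G U))"
    using assms pair_finite_verts pair_finite_arcs
    by (auto simp: induced_graph_def induced_edges_def intro: finite_subset)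
  show "symmetric (with_proj (induced_graph G U))"
    using adj_sym by (auto simp: symmetric_def induced_graph_def induced_edges_def intro: symI)
qed (auto simp: induced_graph_def induced_edges_def)

lemma verts_induced_graph: "pverts (induced_graph G U) = U"
  by (simp add: induced_graph_def)

lemma reachable_induced_graph_iff:
  assumes "u \<in> U"
  shows "u \<rightarrow>\<^sup>*\<^bsub>with_proj (induced_graph G U)\<^esub> v \<longleftrightarrow> (u, v) \<in> (induced_edges G U)\<^sup>*"
proof -
  interpret wf_digraph "with_proj (induced_graph G U)"
    by unfold_locales (auto simp: induced_graph_def induced_edges_def)
  show ?thesis using reachable_conv'[of u v] assms by (simp add: induced_graph_def)
qed

lemma del_vert_induced_graph:
  "pre_digraph.del_vert (with_proj (induced_graph G U)) v = with_proj (induced_graph G (U - {v}))"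
  by (auto simp: pre_digraph.del_vert_def with_proj_def induced_graph_def induced_edges_def)

text \<open>Among the subgraphs without cut vertex around the graph induced by \<open>U\<close>, one with the largest number
  of vertices and arcs is maximal also as a subgraph, because a proper extension has more of them.\<close>

lemma (in pair_graph) biconnected_set_within_block:
  assumes "U \<subseteq> pverts G" "U \<noteq> {}" "biconnected_set G U"
  obtains B where "block (with_proj G) B" "U \<subseteq> verts B" "induced_edges G U \<subseteq> arcs_ends B"
proof -
  define I where "I = with_proj (induced_graph G U)"
  interpret I: pair_graph "induced_graph G U" by (rule pair_graph_induced_graph) fact
  define good where "good H \<longleftrightarrow> subgraph H (with_proj G) \<and> subgraph I H \<and> graph H \<and> connected H \<and>
    (\<nexists>v. cut_vertex H v)" for H
  have "subgraph I (with_proj G)"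
    using assms(1) wf_digraph_axioms I.wf_digraph_axioms
    by (auto simp: subgraph_def compatible_def I_def induced_graph_def induced_edges_def)
  moreover have "subgraph I I" unfolding I_def by (rule I.subgraph_refl)
  moreover have "graph I" unfolding I_def by (rule I.graph_axioms)
  moreover have "connected I"
  proof -
    have "u \<rightarrow>\<^sup>*\<^bsub>mk_symmetric I\<^esub> v" if "u \<in> U" "v \<in> U" for u v
      unfolding I_def I.reachable_mk_symmetric_eq[OF I.sym_arcs] reachable_induced_graph_iff[OF that(1)]
      using that assms(3) by (simp add: biconnected_set_def connected_set_def)
    moreover have "verts I = U" by (simp add: I_def verts_induced_graph)
    ultimately show ?thesis using assms(2)
      unfolding connected_def by (intro strongly_connectedI) simp_all
  qed
  moreover have "\<not> cut_vertex I v" for v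
    using assms(3) unfolding cut_vertex_def I_def del_vert_induced_graph
    by (simp add: verts_induced_graph reachable_induced_graph_iff biconnected_set_def connected_set_def)
  ultimately have "good I" by (simp add: good_def)
  have bound: "card (verts H) + card (arcs H) \<le> card (pverts G) + card (parcs G)" if "good H" for H
  proof -
    have "verts H \<subseteq> pverts G" "arcs H \<subseteq> parcs G"
      using that by (auto simp: good_def subgraph_def)
    then show ?thesis
      using pair_finite_verts pair_finite_arcs by (intro add_mono card_mono) auto
  qed
  have "\<exists>B. good B \<and> (\<forall>H. good H \<longrightarrow>
      card (verts H) + card (arcs H) \<le> card (verts B) + card (arcs B))"
    using \<open>good I\<close> bound
    by (intro ex_has_greatest_nat[of good I _ "Suc (card (pverts G) + card (parcs G))"])
      (simp_all add: less_Suc_eq_le)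
  then obtain B where B: "good B"
    "\<And>H. good H \<Longrightarrow> card (verts H) + card (arcs H) \<le> card (verts B) + card (arcs B)"
    by blast
  have "\<not> (subgraph H (with_proj G) \<and> graph H \<and> connected H \<and> (\<nexists>v. cut_vertex H v))"
    if H: "H \<noteq> B" "subgraph B H" for H
  proof
    assume *: "subgraph H (with_proj G) \<and> graph H \<and> connected H \<and> (\<nexists>v. cut_vertex H v)"
    then have "good H" using B(1) subgraph_trans[OF _ H(2), of I] by (simp add: good_def)
    then have le: "card (verts H) + card (arcs H) \<le> card (verts B) + card (arcs B)" by (rule B(2))
    have fin: "finite (verts H)" "finite (arcs H)"
      using * pair_finite_verts pair_finite_arcs by (auto simp: subgraph_def intro: finite_subset)
    have sub: "verts B \<subseteq> verts H" "arcs B \<subseteq> arcs H" using H(2) by (auto simp: subgraph_def)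
    then have "card (verts B) \<le> card (verts H)" "card (arcs B) \<le> card (arcs H)"
      using fin by (auto intro: card_mono)
    with le have "card (verts B) = card (verts H)" "card (arcs B) = card (arcs H)" by auto
    then have "verts B = verts H" "arcs B = arcs H" using sub fin card_subset_eq by metis+
    moreover have "tail B = tail H" "head B = head H"
      using H(2) by (auto simp: subgraph_def compatible_def)
    ultimately show False using H(1) by (metis pre_digraph.surjective old.unit.exhaust)
  qed
  then have "block (with_proj G) B"
    using B(1) by (auto simp: block_def pre_digraph.max_subgraph_def good_def)
  moreover have "U \<subseteq> verts B" "arcs I \<subseteq> arcs B" "tail B = tail I" "head B = head I"
    using B(1) by (auto simp: good_def subgraph_def compatible_def I_def induced_graph_def)
  then have "U \<subseteq> verts B" "induced_edges G U \<subseteq> arcs_ends B"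
    by (auto simp: I_def induced_graph_def arcs_ends_conv)
  ultimately show ?thesis using that by blast
qed

lemma cycle_degree_le_2:
  assumes "is_cycle H" "(u, x) \<in> arcs_ends H" "(u, y) \<in> arcs_ends H" "(u, z) \<in> arcs_ends H"
  shows "x = y \<or> y = z \<or> x = z"
proof -
  obtain n f where n: "n \<ge> 3" and f: "pre_digraph.digraph_isomorphism H f"
    and app: "with_proj (cycle_graph n) = app_iso f H"
    using assms(1) by (auto simp: is_cycle_def digraph_iso_def)
  have wf: "wf_digraph H" and inj: "inj_on (iso_verts f) (verts H)"
    using f by (auto simp: pre_digraph.digraph_isomorphism_def)
  let ?f = "iso_verts f"
  have *: "?f p < n \<and> ?f q < n \<and> (?f q = (?f p + 1) mod n \<or> ?f p = (?f q + 1) mod n)"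
    "p \<in> verts H" "q \<in> verts H"
    if pq: "(p, q) \<in> arcs_ends H" for p q
  proof -
    obtain e where e: "e \<in> arcs H" "tail H e = p" "head H e = q"
      using pq by (auto simp: arcs_ends_conv)
    then show "p \<in> verts H" "q \<in> verts H" using wf_digraph.wellformed[OF wf] by auto
    have "iso_arcs f e \<in> parcs (cycle_graph n)" 
      using arg_cong[OF app, of arcs] e by simp
    moreover have "fst (iso_arcs f e) = ?f p" "snd (iso_arcs f e) = ?f q"
      using arg_cong[OF app, of tail] arg_cong[OF app, of head] e f
      by (auto simp: pre_digraph.digraph_isomorphism_def)
    ultimately show "?f p < n \<and> ?f q < n \<and> (?f q = (?f p + 1) mod n \<or> ?f p = (?f q + 1) mod n)"
      by (cases "iso_arcs f e") (auto simp: cycle_graph_def)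
  qed
  \<comment> \<open>a vertex of \<open>C\<^sub>n\<close> has, besides its successor, only one predecessor\<close>
  have pred: "p = q" if "(p + 1) mod n = (q + 1) mod n" "p < n" "q < n" for p q
    using that n by (auto simp: mod_Suc split: if_splits)
  have "?f x = ?f y \<or> ?f y = ?f z \<or> ?f x = ?f z"
    using *(1)[OF assms(2)] *(1)[OF assms(3)] *(1)[OF assms(4)] pred by metis
  then show ?thesis
    using inj *(3)[OF assms(2)] *(3)[OF assms(3)] *(3)[OF assms(4)] by (auto dest: inj_onD)
qed

locale block_cactus_graph = pair_graph G for G :: "'a pair_pre_digraph" +
  assumes block_cactus: "block_cactus G"
begin

text \<open>The block around \<open>U\<close> has a vertex of degree three, so it is not a cycle and must be complete.
  The lemmas on short cycles below take unions of cycles for \<open>U\<close>.\<close>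

lemma biconnected_set_clique:
  assumes "biconnected_set G U" "U \<subseteq> pverts G"
    and "u \<in> U" "x \<in> U" "y \<in> U" "z \<in> U" "x \<noteq> y" "y \<noteq> z" "x \<noteq> z"
    and "(u, x) \<in> parcs G" "(u, y) \<in> parcs G" "(u, z) \<in> parcs G"
    and "p \<in> U" "q \<in> U" "p \<noteq> q"
  shows "(p, q) \<in> parcs G"
proof -
  obtain B where B: "block (with_proj G) B" "U \<subseteq> verts B" "induced_edges G U \<subseteq> arcs_ends B"
    using biconnected_set_within_block assms(1-3) by blast
  have "(u, x) \<in> arcs_ends B" "(u, y) \<in> arcs_ends B" "(u, z) \<in> arcs_ends B"
    using B(3) assms by (auto simp: induced_edges_def)
  then have "\<not> is_cycle B" using cycle_degree_le_2 assms(7-9) by metis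
  then obtain n where "K\<^bsub>n\<^esub> B" using B(1) block_cactus by (auto simp: block_cactus_def)
  then have "(p, q) \<in> arcs_ends B"
    using B(2) assms by (auto simp: complete_digraph_def)
  moreover have "subgraph B (with_proj G)"
    using B(1) by (simp add: block_def pre_digraph.max_subgraph_def)
  then have "arcs_ends B \<subseteq> parcs G"
    by (auto simp: subgraph_def compatible_def arcs_ends_conv)
  ultimately show ?thesis by auto
qed

end

section \<open>Locating-dominating sets of a graph and of its complement\<close>

lemma LD_set_subset: "LD_set G S \<Longrightarrow> S \<subseteq> pverts G"
  by (simp add: LD_set_def dominating_set_def)

lemma location_domination_number_le:
  assumes "finite (pverts G)" "LD_set G S"
  shows "location_domination_number G \<le> card S"
proof -
  have "finite {S. LD_set G S}"
    using assms(1) by (auto intro!: finite_subset[of _ "Pow (pverts G)"] dest: LD_set_subset)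
  then show ?thesis using assms(2) by (auto simp: location_domination_number_def)
qed

lemma minimum_LD_set:
  assumes "finite (pverts G)"
  obtains S where "LD_set G S" "card S = location_domination_number G"
proof -
  have "finite {S. LD_set G S}"
    using assms(1) by (auto intro!: finite_subset[of _ "Pow (pverts G)"] dest: LD_set_subset)
  moreover have "LD_set G (pverts G)" by (auto simp: LD_set_def dominating_set_def)
  ultimately have "location_domination_number G \<in> card ` {S. LD_set G S}"
    unfolding location_domination_number_def by (intro Min_in) auto
  then show ?thesis using that by auto
qed

lemma pverts_complement [simp]: "pverts (complement G) = pverts G"
  by (simp add: complement_def)

context pair_graph
begin

abbreviation N :: "'a \<Rightarrow> 'a set" where "N \<equiv> neighborhood G"

lemma N_sym: "u \<in> N v \<longleftrightarrow> v \<in> N u"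
  using adj_sym by (auto simp: neighborhood_def)

lemma N_irrefl [simp]: "v \<notin> N v"
  by (simp add: neighborhood_def)

lemma N_subset: "N v \<subseteq> pverts G"
  using in_arcsD2 by (auto simp: neighborhood_def)

lemma LD_set_iff:
  "LD_set G S \<longleftrightarrow> S \<subseteq> pverts G \<and> (\<forall>v \<in> pverts G - S. N v \<inter> S \<noteq> {}) \<and>
    inj_on (\<lambda>v. N v \<inter> S) (pverts G - S)"
  by (auto simp: LD_set_def dominating_set_def inj_on_def)

text \<open>Outside \<open>S\<close> the traces on \<open>S\<close> in \<open>G\<close> and in its complement are complementary subsets of
  \<open>S\<close>; so both graphs separate the same vertices, and an empty trace in one is a full trace in
  the other.\<close>

lemma LD_set_complement_iff:
  "LD_set (complement G) S \<longleftrightarrow> S \<subseteq> pverts G \<and> (\<forall>v \<in> pverts G - S. \<not> S \<subseteq> N v) \<and>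
    inj_on (\<lambda>v. N v \<inter> S) (pverts G - S)"
proof (cases "S \<subseteq> pverts G")
  case True
  have trace: "neighborhood (complement G) v \<inter> S = S - N v" if "v \<in> pverts G - S" for v
    using that True by (auto simp: complement_def neighborhood_def)
  have "S - N u = S - N v \<longleftrightarrow> N u \<inter> S = N v \<inter> S" for u v by blast
  then show ?thesis
    using True trace by (auto simp: LD_set_def dominating_set_def inj_on_def)
next
  case False
  then show ?thesis using LD_set_subset[of "complement G" S] by auto
qed

text \<open>At most one outside vertex \<open>w\<close> is adjacent to all of \<open>S\<close>, because the traces are distinct;
  only that vertex is left undominated in the complement, and it now belongs to the set.\<close>

lemma LD_set_complement_insert:
  assumes "LD_set G S" "w \<in> pverts G - S" "S \<subseteq> N w"
  shows "LD_set (complement G) (insert w S)"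
  unfolding LD_set_complement_iff
proof (intro conjI ballI notI)
  show "insert w S \<subseteq> pverts G" using assms by (auto simp: LD_set_iff)
  have inj: "inj_on (\<lambda>v. N v \<inter> S) (pverts G - S)" using assms(1) by (simp add: LD_set_iff)
  show "inj_on (\<lambda>v. N v \<inter> insert w S) (pverts G - insert w S)"
  proof (rule inj_onI)
    fix u v assume "u \<in> pverts G - insert w S" "v \<in> pverts G - insert w S"
      "N u \<inter> insert w S = N v \<inter> insert w S"
    then have "N u \<inter> S = N v \<inter> S" by blast
    then show "u = v" using inj \<open>u \<in> _\<close> \<open>v \<in> _\<close> by (auto dest: inj_onD)
  qed
  fix v assume v: "v \<in> pverts G - insert w S" "insert w S \<subseteq> N v"
  then have "N v \<inter> S = N w \<inter> S" using assms(3) by auto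
  then have "v = w" using inj v(1) assms(2) by (auto dest: inj_onD)
  then show False using v(1) by auto
qed

lemma location_domination_number_complement_le:
  "location_domination_number (complement G) \<le> location_domination_number G + 1"
proof -
  obtain S where S: "LD_set G S" "card S = location_domination_number G"
    using minimum_LD_set[OF pair_finite_verts] .
  have fin: "finite S" by (rule finite_subset[OF LD_set_subset[OF S(1)] pair_finite_verts])
  obtain S' where "LD_set (complement G) S'" "card S' \<le> card S + 1"
  proof (cases "\<exists>w \<in> pverts G - S. S \<subseteq> N w")
    case True
    then show ?thesis using that LD_set_complement_insert[OF S(1)] fin by (metis DiffD2 Suc_eq_plus1 card_insert_disjoint order_refl)
  next
    case False
    then have "LD_set (complement G) S"
      using S(1) by (auto simp: LD_set_complement_iff LD_set_iff)
    then show ?thesis using that by auto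
  qed
  then show ?thesis
    using location_domination_number_le[of "complement G" S'] pair_finite_verts S(2) by auto
qed

end

section \<open>Short cycles in a block-cactus\<close>

context block_cactus_graph
begin

text \<open>Two triangles on the common edge \<open>u v\<close> form a biconnected set in which \<open>u\<close> has degree three.\<close>

lemma diamond_free:
  assumes "v \<in> N u" "p \<in> N u" "p \<in> N v" "q \<in> N u" "q \<in> N v" "p \<noteq> q"
  shows "q \<in> N p"
proof -
  have "biconnected_set G {u, v, p}" "biconnected_set G {u, v, q}"
    using assms N_sym by (auto simp: neighborhood_def intro!: biconnected_set_triangle)
  then have "biconnected_set G ({u, v, p} \<union> {u, v, q})"
    using assms(1) by (intro biconnected_set_Un[of _ _ _ u v]) auto
  moreover have "{u, v, p} \<union> {u, v, q} \<subseteq> pverts G"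
    using assms N_subset N_sym by blast
  ultimately have "(p, q) \<in> parcs G"
    by (rule biconnected_set_clique[of _ u v p q]) (use assms in \<open>auto simp: neighborhood_def\<close>)
  then show ?thesis by (simp add: neighborhood_def)
qed

text \<open>
  A biconnected set \<open>W\<close> sharing two vertices with the cycle would form with it a biconnected set in
  which \<open>u\<close> has its two neighbors on the cycle and \<open>e\<close>; then the cycle would have the chord \<open>a c\<close>.\<close>

lemma cycle4_no_ear:
  assumes "b \<in> N a" "c \<in> N b" "d \<in> N c" "a \<in> N d" "a \<noteq> c" "b \<noteq> d" "c \<notin> N a"
    and W: "biconnected_set G W" "W \<subseteq> pverts G"
    and "{x, y} \<subseteq> W \<inter> {a, b, c, d}" "x \<noteq> y"
    and "u \<in> {a, b, c, d}" "e \<in> W - {a, b, c, d}" "e \<in> N u"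
  shows False
proof -
  have adj: "(a, b) \<in> parcs G" "(b, c) \<in> parcs G" "(c, d) \<in> parcs G" "(d, a) \<in> parcs G"
    using assms(1-4) by (auto simp: neighborhood_def)
  have "biconnected_set G {a, b, c, d}"
    using adj assms(5,6) by (intro biconnected_set_cycle4)
  then have bic: "biconnected_set G ({a, b, c, d} \<union> W)"
    using W(1) assms(10,11) by (intro biconnected_set_Un[of _ _ _ x y]) auto
  have sub: "{a, b, c, d} \<union> W \<subseteq> pverts G"
    using W(2) adj in_arcsD1 by blast
  obtain f g where "f \<in> {a, b, c, d}" "g \<in> {a, b, c, d}" "f \<noteq> g" "(u, f) \<in> parcs G" "(u, g) \<in> parcs G"
  proof -
    consider "u = a" | "u = b" | "u = c" | "u = d" using assms(12) by auto
    then show ?thesis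
    proof cases
      case 1 then show ?thesis using adj adj_sym[OF adj(4)] assms(6) by (intro that[of b d]) simp_all
    next
      case 2 then show ?thesis using adj adj_sym[OF adj(1)] assms(5) by (intro that[of a c]) simp_all
    next
      case 3 then show ?thesis using adj adj_sym[OF adj(2)] assms(6) by (intro that[of b d]) simp_all
    next
      case 4 then show ?thesis using adj adj_sym[OF adj(3)] assms(5) by (intro that[of a c]) simp_all
    qed
  qed
  moreover have "f \<noteq> e" "g \<noteq> e" "e \<in> {a, b, c, d} \<union> W" "(u, e) \<in> parcs G"
    using \<open>f \<in> _\<close> \<open>g \<in> _\<close> assms(13,14) by (auto simp: neighborhood_def)
  ultimately have "(a, c) \<in> parcs G"
    using assms(5,12) biconnected_set_clique[OF bic sub, of u f g e a c] by blast
  then show False using assms(7) by (simp add: neighborhood_def)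
qed

end

section \<open>A minimum LD-set inside a neighborhood\<close>

lemma inj_on_insertI:
  "inj_on f A \<Longrightarrow> (\<And>x. x \<in> A \<Longrightarrow> f x \<noteq> f a) \<Longrightarrow> inj_on f (insert a A)"
  unfolding inj_on_def by (metis insert_iff)

text \<open>If the number of the complement exceeds that of \<open>G\<close>, then every minimum LD-set \<open>S\<close> of \<open>G\<close> fails in the
  complement, which provides \<open>w\<close>, and no set of the size of \<open>S\<close> is an LD-set there.\<close>

locale universally_dominated_LD_set = block_cactus_graph G for G :: "'a pair_pre_digraph" +
  fixes S :: "'a set" and w :: 'a
  assumes LD: "LD_set G S"
    and w: "w \<in> pverts G" "w \<notin> S"
    and S_sub_Nw: "S \<subseteq> N w"
    and minimal: "\<And>S'. LD_set (complement G) S' \<Longrightarrow> card S < card S'"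
begin

abbreviation T :: "'a \<Rightarrow> 'a set" where "T v \<equiv> N v \<inter> S"

text \<open>The outside vertices adjacent to \<open>w\<close>, and those at distance two from it: as \<open>S\<close> is dominating and
  contained in \<open>N w\<close>, there are no others.\<close>

definition X :: "'a set" where "X = N w - S"

definition Z :: "'a set" where "Z = pverts G - N w - {w}"

lemma finite_S: "finite S"
  by (rule finite_subset[OF LD_set_subset[OF LD] pair_finite_verts])

lemma verts_eq: "pverts G = insert w (S \<union> X \<union> Z)"
  using w N_subset LD_set_subset[OF LD] by (auto simp: X_def Z_def)

lemma outside: "pverts G - S = insert w (X \<union> Z)" "w \<notin> X \<union> Z"
  using w N_subset S_sub_Nw by (auto simp: X_def Z_def)

lemma trace_nonempty: "v \<in> insert w (X \<union> Z) \<Longrightarrow> T v \<noteq> {}"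
  using LD outside by (auto simp: LD_set_iff)

lemma trace_inj: "u \<in> insert w (X \<union> Z) \<Longrightarrow> v \<in> insert w (X \<union> Z) \<Longrightarrow> T u = T v \<Longrightarrow> u = v"
  using LD unfolding LD_set_iff outside by (auto dest: inj_onD)

lemma trace_not_full: "v \<in> X \<union> Z \<Longrightarrow> T v \<noteq> S"
  using trace_inj[of v w] S_sub_Nw outside(2) by auto

text \<open>The new outside vertices are given as an explicit set \<open>R\<close>, so that traces can be compared one
  inserted vertex at a time.\<close>

lemma exchange_impossible:
  assumes "S' \<subseteq> pverts G" "card S' \<le> card S"
    and "pverts G - S' = R" "inj_on (\<lambda>v. N v \<inter> S') R" "\<And>v. v \<in> R \<Longrightarrow> \<not> S' \<subseteq> N v"
  shows False
proof -
  have "LD_set (complement G) S'" using assms by (simp add: LD_set_complement_iff)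
  then show False using minimal assms(2) by fastforce
qed

text \<open>Adjacency is transitive on \<open>N w\<close>, which therefore induces a disjoint union of cliques.\<close>

lemma Nw_trans:
  assumes "a \<in> N w" "b \<in> N w" "c \<in> N w" "b \<in> N a" "c \<in> N b" "a \<noteq> c"
  shows "c \<in> N a"
  using diamond_free[of b w a c] assms N_sym by auto

subsection \<open>Vertices at distance two have one neighbor in the set\<close>

text \<open>A vertex \<open>v\<close> of \<open>Z\<close> with two neighbors \<open>a\<close> and \<open>b\<close> in \<open>S\<close> lies on the chordless 4-cycle \<open>w a v b\<close>. The
  cycle is a block, and the next lemmas collect what this forbids around it.\<close>

context
  fixes a v b
  assumes v: "v \<in> Z" and a: "a \<in> T v" and b: "b \<in> T v" and ab: "a \<noteq> b"
begin

lemma cycle4_ear_impossible: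
  assumes "biconnected_set G W" "W \<subseteq> pverts G" "{x, y} \<subseteq> W \<inter> {w, a, v, b}" "x \<noteq> y"
    "u \<in> {w, a, v, b}" "e \<in> W - {w, a, v, b}" "e \<in> N u"
  shows False
proof -
  have "a \<in> N w" "v \<in> N a" "b \<in> N v" "w \<in> N b" "w \<noteq> v" "v \<notin> N w"
    using v a b S_sub_Nw N_sym by (auto simp: Z_def)
  then show False by (rule cycle4_no_ear[OF _ _ _ _ _ ab _ assms])
qed

text \<open>
  A common neighbor \<open>e\<close> of \<open>w\<close> and \<open>a\<close> would close a triangle on an edge of the cycle, or a diamond if
  \<open>e\<close> is \<open>b\<close>.\<close>

lemma cycle4_isolated:
  assumes "e \<in> N w"
  shows "e \<notin> N a"
proof
  assume e: "e \<in> N a"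
  have aw: "a \<in> N w" using a S_sub_Nw by auto
  show False
  proof (cases "e = b")
    case True
    then show ?thesis
      using diamond_free[of a b w v] e v a b aw S_sub_Nw N_sym by (auto simp: Z_def)
  next
    case False
    have "biconnected_set G {w, a, e}"
      using aw e assms N_sym by (intro biconnected_set_triangle) (auto simp: neighborhood_def)
    moreover have "e \<notin> {w, a, v, b}" using False e assms v by (auto simp: Z_def)
    ultimately show ?thesis
      using cycle4_ear_impossible[of "{w, a, e}" w a w e] assms aw a w N_subset by auto
  qed
qed

end

text \<open>A second neighbor \<open>s\<close> of \<open>r\<close> in \<open>S\<close> would give another 4-cycle \<open>w b r s\<close> through the edge \<open>w b\<close>.\<close>

lemma cycle4_trace:
  assumes v: "v \<in> Z" "a \<in> T v" "b \<in> T v" "a \<noteq> b"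
    and r: "r \<in> X \<union> Z" "r \<noteq> v" "b \<in> T r"
  shows "T r = {b}"
proof (rule ccontr)
  assume "T r \<noteq> {b}"
  then obtain s where s: "s \<in> T r" "s \<noteq> b" using r(3) by auto
  have rw: "r \<noteq> w" using r(1) outside(2) by auto
  have "r \<notin> N w" using cycle4_isolated[of v b a r] v r(3) N_sym by auto
  have inw: "s \<in> N w" "b \<in> N w" "a \<in> N w" using s r v S_sub_Nw by auto
  have bic: "biconnected_set G {w, b, r, s}"
    using inw s r(3) rw N_sym by (intro biconnected_set_cycle4) (auto simp: neighborhood_def)
  have sub: "{w, b, r, s} \<subseteq> pverts G"
    using w(1) s r(3) LD_set_subset[OF LD] N_subset N_sym by blast
  have rS: "r \<notin> S" using r(1) outside by (auto simp: X_def Z_def)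
  have sv: "s \<noteq> v" "s \<noteq> w" using s v(1) w(2) S_sub_Nw by (auto simp: Z_def)
  show False
  proof (cases "s = a")
    case True
    have "r \<notin> {w, a, v, b}" using rw r(2) rS v by auto
    then show ?thesis
      using cycle4_ear_impossible[OF v bic sub, of w b b r] inw r(3) w(2) N_sym by auto
  next
    case False
    then show ?thesis
      using cycle4_ear_impossible[OF v bic sub, of w b w s] inw s sv r(3) w(2) by auto
  qed
qed

text \<open>Some \<open>s\<close> in \<open>S\<close> is adjacent to \<open>r\<close>. If \<open>v\<close> and \<open>r\<close> were adjacent, then \<open>v r s\<close> would be a triangle on
  an edge of the cycle when \<open>s\<close> is \<open>a\<close> or \<open>b\<close>, and otherwise \<open>w a v r s\<close> would be a 5-cycle sharing the
  path \<open>w a v\<close> with it.\<close>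

lemma cycle4_nonadjacent:
  assumes v: "v \<in> Z" "a \<in> T v" "b \<in> T v" "a \<noteq> b" and r: "r \<in> X \<union> Z"
  shows "v \<notin> N r"
proof
  assume adj: "v \<in> N r"
  have rS: "r \<notin> S" "r \<noteq> w" using r outside by (auto simp: X_def Z_def)
  have inw: "b \<in> N w" "a \<in> N w" using v S_sub_Nw by auto
  have out: "r \<notin> {w, a, v, b}" using adj rS v by auto
  have verts: "r \<in> pverts G" "v \<in> pverts G" "w \<in> pverts G" "a \<in> pverts G" "b \<in> pverts G"
    using r verts_eq v by auto
  obtain s where s: "s \<in> T r" using trace_nonempty[of r] r by auto
  show False
  proof (cases "s = a \<or> s = b")
    case True
    have bic: "biconnected_set G {v, r, s}"
      using adj s True v N_sym by (intro biconnected_set_triangle) (auto simp: neighborhood_def)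
    have "v \<notin> S" using v(1) S_sub_Nw by (auto simp: Z_def)
    then have "v \<noteq> s" using s by auto
    then show ?thesis
      using cycle4_ear_impossible[OF v bic, of v s s r] True verts out s v N_sym by auto
  next
    case False
    have sw: "s \<in> N w" "s \<in> pverts G" using s S_sub_Nw N_subset by auto
    have "distinct [w, a, v, r, s]"
      using out s False v w rS S_sub_Nw by (auto simp: Z_def)
    then have bic: "biconnected_set G {w, a, v, r, s}"
      using inw sw adj s v N_sym by (intro biconnected_set_cycle5) (auto simp: neighborhood_def)
    show ?thesis
      using cycle4_ear_impossible[OF v bic, of w a v r] adj N_sym verts out sw \<open>distinct _\<close> by auto
  qed
qed

text \<open>If \<open>v\<close> had two neighbors \<open>a\<close> and \<open>b\<close> in \<open>S\<close>, then \<open>b\<close> could be traded for \<open>v\<close>. Of the new outside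
  vertices only \<open>b\<close> sees \<open>v\<close>. The traces of the vertices other than \<open>b\<close> and \<open>w\<close> lose at most \<open>b\<close> and
  stay distinct, because one that contains \<open>b\<close> is \<open>{b}\<close> and becomes the only empty one. The trace of
  \<open>w\<close> still contains \<open>a\<close>; if another vertex shared it, then it would be \<open>{a}\<close>, and \<open>T v\<close> would be all
  of \<open>S\<close>.\<close>

lemma trace_Z_singleton:
  assumes "v \<in> Z"
  obtains s where "T v = {s}"
proof (rule ccontr)
  assume "\<not> thesis"
  then have "\<nexists>s. T v = {s}" using that by auto
  moreover obtain a where a: "a \<in> T v" using trace_nonempty assms by blast
  ultimately obtain b where b: "b \<in> T v" "a \<noteq> b" by blast
  note va = assms a b
  note vb = assms b(1) a b(2)[symmetric]
  have vw: "v \<notin> N w" "v \<notin> S" "v \<noteq> w" "v \<in> pverts G" using assms S_sub_Nw by (auto simp: Z_def)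
  define S' where "S' = insert v (S - {b})"
  define R where "R = X \<union> Z - {v}"
  have Rtrace: "N r \<inter> S' = T r - {b}" if "r \<in> R" for r
    using that cycle4_nonadjacent[OF va, of r] by (auto simp: R_def S'_def)
  have wtrace: "N w \<inter> S' = S - {b}" using vw S_sub_Nw by (auto simp: S'_def)
  have "N b \<inter> S = {}" using cycle4_isolated[OF vb] S_sub_Nw by auto
  then have btrace: "N b \<inter> S' = {v}" using b N_sym by (auto simp: S'_def)
  have bR: "T r = {b}" if "r \<in> R" "b \<in> T r" for r
    using that cycle4_trace[OF va, of r] by (auto simp: R_def)
  have aR: "T r = {a}" if "r \<in> R" "a \<in> T r" for r
    using that cycle4_trace[OF vb, of r] by (auto simp: R_def)
  have RXZ: "r \<in> insert w (X \<union> Z)" if "r \<in> R" for r using that by (auto simp: R_def)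
  show False
  proof (rule exchange_impossible[of S' "insert b (insert w R)"])
    show "S' \<subseteq> pverts G" using LD_set_subset[OF LD] vw by (auto simp: S'_def)
    show "card S' \<le> card S"
      using finite_S b vw card_Suc_Diff1[of S b] by (simp add: S'_def)
    show "pverts G - S' = insert b (insert w R)"
      using verts_eq outside b vw w by (auto simp: S'_def R_def)
    have "inj_on (\<lambda>r. T r - {b}) R"
    proof (rule inj_onI)
      fix r r' assume r: "r \<in> R" "r' \<in> R" "T r - {b} = T r' - {b}"
      have "b \<in> T q'" if "q \<in> R" "q' \<in> R" "T q - {b} = T q' - {b}" "b \<in> T q" for q q'
        using bR[OF that(1,4)] trace_nonempty[OF RXZ[OF that(2)]] that(3) by auto
      then have "b \<in> T r \<longleftrightarrow> b \<in> T r'" using r by metis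
      then have "T r = T r'" using r(3) by blast
      then show "r = r'" by (rule trace_inj[OF RXZ[OF r(1)] RXZ[OF r(2)]])
    qed
    moreover have "T r - {b} \<noteq> S - {b}" if r: "r \<in> R" for r
    proof
      assume eq: "T r - {b} = S - {b}"
      then have "a \<in> T r" using a b by auto
      with aR[OF r] have "T r = {a}" .
      with eq have "S = {a, b}" using a b by auto
      then have "T v = S" using a b by auto
      then show False using trace_not_full assms by auto
    qed
    moreover have "inj_on (\<lambda>r. N r \<inter> S') R \<longleftrightarrow> inj_on (\<lambda>r. T r - {b}) R"
      by (rule inj_on_cong) (rule Rtrace)
    moreover have "v \<notin> N w \<inter> S'" "\<And>r. r \<in> R \<Longrightarrow> v \<notin> N r \<inter> S'"
      using Rtrace vw by auto
    ultimately show "inj_on (\<lambda>r. N r \<inter> S') (insert b (insert w R))"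
      using wtrace btrace Rtrace by (intro inj_on_insertI) auto
    show "\<not> S' \<subseteq> N r" if "r \<in> insert b (insert w R)" for r
    proof -
      have "a \<in> S'" "v \<in> S'" using a b by (auto simp: S'_def)
      moreover have "a \<notin> N b" using cycle4_isolated[OF vb] a S_sub_Nw by auto
      ultimately show ?thesis
        using that vw(1) cycle4_nonadjacent[OF va, of r] by (auto simp: R_def)
    qed
  qed
qed

subsection \<open>Traces of the neighbors of the center\<close>

text \<open>The trace of \<open>x\<close> is the part in \<open>S\<close> of the clique of \<open>N w\<close> that contains \<open>x\<close>.\<close>

lemma neighbors_in_S:
  assumes "x \<in> X" "s \<in> T x"
  shows "N s \<inter> S = T x - {s}"
proof -
  have x: "x \<in> N w" "x \<notin> S" "s \<in> N w" using assms S_sub_Nw by (auto simp: X_def)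
  have "t \<in> N x" if "t \<in> N s" "t \<in> S" for t
    using Nw_trans[of x s t] that x assms S_sub_Nw by auto
  moreover have "t \<in> N s" if "t \<in> N x" "t \<in> S" "t \<noteq> s" for t
    using Nw_trans[of s x t] that x assms S_sub_Nw N_sym by auto
  ultimately show ?thesis by auto
qed

text \<open>Two outside vertices in one clique of \<open>N w\<close> would have the same trace.\<close>

lemma X_trace_disjoint:
  assumes "x \<in> X" "y \<in> X" "s \<in> T x" "s \<in> T y"
  shows "x = y"
proof -
  have "T x - {s} = T y - {s}" using neighbors_in_S assms by metis
  then have "T x = T y" using assms(3,4) by blast
  then show ?thesis using trace_inj assms(1,2) by simp
qed

text \<open>Let \<open>s\<close> be the neighbor of \<open>z\<close> in \<open>S\<close>. An edge \<open>x z\<close> would make \<open>w\<close> and \<open>z\<close> the tips of a diamond on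
  \<open>s x\<close> if \<open>s\<close> and \<open>x\<close> are adjacent. Otherwise \<open>w x z s\<close> would be a chordless 4-cycle, and a neighbor \<open>t\<close>
  of \<open>x\<close> in \<open>S\<close> closes a triangle on its edge \<open>w x\<close>.\<close>

lemma Z_X_nonadjacent:
  assumes "z \<in> Z" "x \<in> X"
  shows "x \<notin> N z"
proof
  assume xz: "x \<in> N z"
  obtain s where s: "T z = {s}" using trace_Z_singleton assms(1) .
  have x: "x \<in> N w" "x \<notin> S" "x \<in> pverts G" using assms(2) N_subset by (auto simp: X_def)
  have z: "z \<notin> N w" "z \<noteq> w" "z \<notin> S" "z \<in> pverts G" using assms(1) S_sub_Nw by (auto simp: Z_def)
  have sS: "s \<in> S" "s \<in> N z" using s by auto
  then have sw: "s \<in> N w" "s \<in> pverts G" using S_sub_Nw N_subset by auto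
  show False
  proof (cases "s \<in> N x")
    case True
    then show ?thesis
      using diamond_free[of s x w z] x z sw sS xz N_sym by auto
  next
    case False
    obtain t where t: "t \<in> T x" using trace_nonempty assms(2) by blast
    then have tw: "t \<in> N w" "t \<in> pverts G" "t \<in> N x" "t \<in> S" using S_sub_Nw N_subset by auto
    have "biconnected_set G {w, x, t}"
      using x tw N_sym by (intro biconnected_set_triangle) (auto simp: neighborhood_def)
    moreover have "{w, x, t} \<subseteq> pverts G" using x tw w by auto
    moreover have "t \<notin> {w, x, z, s}" using tw x z w False by auto
    moreover have "z \<in> N x" "w \<in> N s" using xz sw N_sym by auto
    ultimately show False
      using cycle4_no_ear[of x w z s "{w, x, t}" w x w t] x z sS sw tw by auto
  qed
qed

text \<open>
  Consider trading \<open>s\<close> for \<open>w\<close>. The traces of \<open>X\<close> gain \<open>w\<close>, and those of \<open>Z\<close>, being singletons, stay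
  distinct even if one of them becomes empty; \<open>s\<close> is told apart from every vertex of \<open>X\<close> because it lies
  in another clique of \<open>N w\<close>. So the exchange can fail only through a full trace, and the two
  alternatives are a full trace of \<open>s\<close> or of a vertex of \<open>X\<close>.\<close>

lemma exchange_center:
  assumes "s \<in> S" "N s \<inter> X = {}"
  shows "S - {s} \<subseteq> N s \<or> (\<exists>x\<in>X. T x = S - {s})"
proof (rule ccontr)
  assume not: "\<not> ?thesis"
  define S' where "S' = insert w (S - {s})"
  define R where "R = X \<union> Z"
  have sX: "s \<notin> T x" if "x \<in> X" for x using that assms(2) N_sym by auto
  have Xtrace: "N x \<inter> S' = insert w (T x)" if "x \<in> X" for x
    using that sX[OF that] N_sym by (auto simp: S'_def X_def)
  have Ztrace: "N z \<inter> S' = T z - {s}" if "z \<in> Z" for z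
    using that N_sym by (auto simp: S'_def Z_def)
  have strace: "N s \<inter> S' = insert w (N s \<inter> S)"
    using assms(1) S_sub_Nw N_sym by (auto simp: S'_def)
  show False
  proof (rule exchange_impossible[of S' "insert s R"])
    show "S' \<subseteq> pverts G" using LD_set_subset[OF LD] w by (auto simp: S'_def)
    show "card S' \<le> card S"
      using finite_S assms(1) w card_Suc_Diff1[of S s] by (simp add: S'_def)
    show "pverts G - S' = insert s R"
      using outside assms(1) verts_eq by (auto simp: S'_def R_def)
    have "inj_on (\<lambda>r. N r \<inter> S') X"
    proof (rule inj_onI)
      fix x y assume "x \<in> X" "y \<in> X" "N x \<inter> S' = N y \<inter> S'"
      then have "T x = T y" using Xtrace w(2) by auto
      then show "x = y" using trace_inj \<open>x \<in> X\<close> \<open>y \<in> X\<close> by simp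
    qed
    moreover have "inj_on (\<lambda>r. N r \<inter> S') Z"
    proof (rule inj_onI)
      fix y z assume yz: "y \<in> Z" "z \<in> Z" "N y \<inter> S' = N z \<inter> S'"
      obtain a b where "T y = {a}" "T z = {b}" using trace_Z_singleton yz(1,2) by metis
      then have "T y = T z" using yz Ztrace by (auto simp: insert_Diff_if split: if_splits)
      then show "y = z" using trace_inj yz(1,2) by simp
    qed
    moreover have "N x \<inter> S' \<noteq> N z \<inter> S'" if "x \<in> X" "z \<in> Z" for x z
      using that Xtrace[of x] Ztrace[of z] w(2) by auto
    ultimately have "inj_on (\<lambda>r. N r \<inter> S') R"
      unfolding R_def inj_on_def by (metis UnE)
    moreover have "N r \<inter> S' \<noteq> N s \<inter> S'" if "r \<in> R" for r
    proof
      assume eq: "N r \<inter> S' = N s \<inter> S'"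
      have rX: "r \<in> X" using that eq strace Ztrace[of r] w(2) by (auto simp: R_def)
      then have "T r = N s \<inter> S" using eq strace Xtrace[of r] w(2) by auto
      moreover obtain t where "t \<in> T r" using trace_nonempty rX by blast
      ultimately have "r \<in> N s"
        using Nw_trans[of s t r] assms(1) rX S_sub_Nw N_sym by (auto simp: X_def)
      then show False using assms(2) rX by auto
    qed
    ultimately show "inj_on (\<lambda>r. N r \<inter> S') (insert s R)" by (rule inj_on_insertI)
    show "\<not> S' \<subseteq> N r" if rR: "r \<in> insert s R" for r
    proof
      assume full: "S' \<subseteq> N r"
      have "r \<notin> Z" using full N_sym by (auto simp: S'_def Z_def)
      then consider "r = s" | "r \<in> X" using rR by (auto simp: R_def)
      then show False
      proof cases
        case 1
        then show ?thesis using not full by (auto simp: S'_def)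
      next
        case 2
        then have "T r = S - {s}" using full sX[OF 2] by (auto simp: S'_def)
        then show ?thesis using not 2 by blast
      qed
    qed
  qed
qed

text \<open>On the 5-cycle \<open>w s z z' s'\<close> a common neighbor of \<open>w\<close> and \<open>s\<close>, which may be \<open>s'\<close>, gives \<open>s\<close> a third
  neighbor, which would make \<open>w\<close> adjacent to \<open>z\<close>.\<close>

lemma cycle5_isolated:
  assumes z: "z \<in> Z" "z' \<in> Z" "z' \<in> N z" and s: "s \<in> T z" "s' \<in> T z'" "s \<noteq> s'"
  shows "N w \<inter> N s = {}"
proof (rule ccontr)
  let ?C = "{w, s, z, z', s'}"
  assume "N w \<inter> N s \<noteq> {}"
  then obtain e where e: "e \<in> N w" "e \<in> N s" by auto
  have zw: "z \<notin> N w" "z \<noteq> w" "z \<in> pverts G" "z' \<notin> N w" "z' \<noteq> w" "z' \<in> pverts G"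
    using z by (auto simp: Z_def)
  have sw: "s \<in> N w" "s' \<in> N w" "s \<in> pverts G" "s' \<in> pverts G"
    using s S_sub_Nw N_subset by auto
  have "distinct [w, s, z, z', s']" using zw sw s z by auto
  then have bic: "biconnected_set G ?C"
    using z s sw N_sym by (intro biconnected_set_cycle5) (auto simp: neighborhood_def)
  have arcs: "(s, w) \<in> parcs G" "(s, z) \<in> parcs G" "(s, e) \<in> parcs G"
    using s sw e N_sym[of s w] N_sym[of s z] by (auto simp: neighborhood_def)
  have ne: "e \<noteq> w" "e \<noteq> z" "e \<noteq> s" using e zw by auto
  have "biconnected_set G {w, s, e}"
    using sw e N_sym by (intro biconnected_set_triangle) (auto simp: neighborhood_def)
  then have "biconnected_set G (?C \<union> {w, s, e})"
    using bic sw by (intro biconnected_set_Un[of _ _ _ w s]) auto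
  moreover have "?C \<union> {w, s, e} \<subseteq> pverts G"
    using zw sw w e N_subset by auto
  ultimately have "(w, z) \<in> parcs G"
    by (rule biconnected_set_clique[of _ s w z e]) (use arcs ne zw in auto)
  then show False using zw by (simp add: neighborhood_def)
qed

text \<open>An edge inside \<open>Z\<close> lies on a 5-cycle \<open>w s z z' s'\<close>. Then \<open>s\<close> and \<open>s'\<close> have no neighbors in \<open>N w\<close>, so
  trading \<open>s\<close> for \<open>w\<close> runs into neither alternative of \<open>exchange_center\<close>.\<close>

lemma Z_independent:
  assumes "z \<in> Z" "z' \<in> Z"
  shows "z' \<notin> N z"
proof
  assume adj: "z' \<in> N z"
  obtain s s' where s: "T z = {s}" "T z' = {s'}" using trace_Z_singleton assms by metis
  have ne: "s \<noteq> s'" using trace_inj[of z z'] assms s adj by auto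
  have sS: "s \<in> S" "s' \<in> S" "s' \<in> N w" using s S_sub_Nw by auto
  have iso: "N w \<inter> N s = {}"
    using cycle5_isolated[of z z' s s'] assms adj s ne by auto
  have iso': "N w \<inter> N s' = {}"
    using cycle5_isolated[of z' z s' s] assms adj s ne N_sym by auto
  have "N s \<inter> X = {}" using iso by (auto simp: X_def)
  then consider "S - {s} \<subseteq> N s" | x where "x \<in> X" "T x = S - {s}"
    using exchange_center[OF sS(1)] by blast
  then show False
  proof cases
    case 1
    then show ?thesis using iso sS ne by auto
  next
    case (2 x)
    then have "x \<in> N s'" "x \<in> N w" using sS ne N_sym by (auto simp: X_def)
    then show ?thesis using iso' by auto
  qed
qed

text \<open>When \<open>z\<close> is moved into the set, it enters only the trace of its neighbor in \<open>S\<close>.\<close>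

lemma pendant_not_adjacent_outside:
  assumes "z \<in> Z" "r \<in> insert w (X \<union> Z)"
  shows "z \<notin> N r"
  using assms Z_independent[of r z] Z_X_nonadjacent[of z r] N_sym[of r z] by (auto simp: Z_def)

subsection \<open>No pendant vertex hangs on a clique with an outside vertex\<close>

text \<open>Trading \<open>s\<close> alone for \<open>z\<close> would leave \<open>x\<close> and \<open>z'\<close> with the common trace \<open>{s'}\<close>. Instead both \<open>s\<close> and
  \<open>s'\<close> are traded, for \<open>z\<close> and \<open>x\<close>: the new traces of \<open>s\<close>, \<open>s'\<close> and \<open>z'\<close> are \<open>{z, x}\<close>, \<open>{x}\<close> and empty,
  and that of \<open>w\<close> contains \<open>x\<close> together with the vertices of \<open>S\<close> in other cliques.\<close>

lemma no_pendants_on_both_ends: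
  assumes x: "x \<in> X" "s \<in> T x" and s': "T x = {s, s'}" "s' \<noteq> s"
    and z: "z \<in> Z" "T z = {s}" and z': "z' \<in> Z" "T z' = {s'}"
  shows False
proof -
  have xw: "x \<in> N w" "x \<notin> S" "x \<in> pverts G" using x N_subset by (auto simp: X_def)
  have zw: "z \<notin> N w" "z \<notin> S" "z \<noteq> w" "z \<in> pverts G" using z S_sub_Nw by (auto simp: Z_def)
  have sS: "s \<in> S" "s \<in> N x" "s \<in> N z" using x z by auto
  have xz: "x \<noteq> z" using xw zw by auto
  have not_full: "T x \<noteq> S" using trace_not_full x by auto
  have Ns: "N s \<inter> S = T x - {s}" by (rule neighbors_in_S) fact+
  have S_disjoint: "S \<inter> (X \<union> Z) = {}" using outside by blast
  have others: "v = x" if "v \<in> X" "t \<in> T v" "t \<in> T x" for v t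
    using X_trace_disjoint that x by blast
  define S' where "S' = insert z (insert x (S - {s, s'}))"
  define R where "R = X \<union> Z - {z, x}"
  have s'S: "s' \<in> S" "s' \<in> N x" using s' by auto
  have Ns': "N s' \<inter> S = {s}" using neighbors_in_S[of x s'] x s' by auto
  have xX: "x \<notin> N r" if "r \<in> X \<union> Z" for r
  proof
    assume xr: "x \<in> N r"
    then have "r \<in> X" using that Z_X_nonadjacent x by auto
    then have rw: "r \<in> N w" "r \<notin> S" by (auto simp: X_def)
    have "r \<in> N s"
      using Nw_trans[of s x r] rw xw xr sS S_sub_Nw N_sym by auto
    then have "s \<in> T r" using sS N_sym by auto
    then have "r = x" using others[of r s] \<open>r \<in> X\<close> x by auto
    then show False using xr by auto
  qed
  have Rtrace: "N r \<inter> S' = T r - {s, s'}" if "r \<in> R" for r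
    using that pendant_not_adjacent_outside[OF z(1), of r] xX[of r] by (auto simp: S'_def R_def)
  have wtrace: "N w \<inter> S' = insert x (S - {s, s'})"
    using zw xw S_sub_Nw by (auto simp: S'_def)
  have strace: "N s \<inter> S' = {z, x}"
    using Ns s' sS N_sym by (auto simp: S'_def)
  have "z \<notin> N s'" using z(2) s' s'S N_sym by auto
  then have s'trace: "N s' \<inter> S' = {x}"
    using Ns' s'S N_sym by (auto simp: S'_def)
  have R_cases: "r = z' \<or> T r \<inter> {s, s'} = {}" if "r \<in> R" for r
  proof (cases "r \<in> X")
    case True
    then show ?thesis using others[of r s] others[of r s'] s' that by (auto simp: R_def)
  next
    case False
    then have r: "r \<in> Z" "r \<noteq> z" using that by (auto simp: R_def)
    then obtain t where "T r = {t}" using trace_Z_singleton by metis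
    then show ?thesis using r z z' trace_inj[of r z] trace_inj[of r z'] by auto
  qed
  \<comment> \<open>\<open>t\<close> stays in the set and is adjacent to neither \<open>s\<close> nor \<open>s'\<close>\<close>
  obtain t where t: "t \<in> S" "t \<notin> T x" using not_full by auto
  show False
  proof (rule exchange_impossible[of S' "insert s (insert s' (insert w R))"])
    show "S' \<subseteq> pverts G" using LD_set_subset[OF LD] zw xw by (auto simp: S'_def)
    have "card {s, s'} \<le> card S" using sS s'S finite_S by (intro card_mono) auto
    then have "card (S - {s, s'}) + 2 = card S"
      using sS s'S s'(2) by (simp add: card_Diff_subset)
    then show "card S' \<le> card S"
      using finite_S zw xw xz by (simp add: S'_def)
    show "pverts G - S' = insert s (insert s' (insert w R))"
      unfolding verts_eq S'_def R_def using sS(1) s'S(1) zw(2,3) xw(2) w(2) x(1) z(1) outside(2) S_disjoint by auto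
    have "inj_on (\<lambda>r. N r \<inter> S') R"
    proof (rule inj_onI)
      fix r r' assume r: "r \<in> R" "r' \<in> R" and "N r \<inter> S' = N r' \<inter> S'"
      then have eq: "T r - {s, s'} = T r' - {s, s'}" using Rtrace by simp
      have ne: "T r \<noteq> {}" "T r' \<noteq> {}" using trace_nonempty r by (auto simp: R_def)
      show "r = r'"
      proof (cases "r = z' \<or> r' = z'")
        case True
        have "q' = z'" if "q' \<in> R" "T q' \<noteq> {}" "T z' - {s, s'} = T q' - {s, s'}" for q'
          using R_cases[OF that(1)] that(2,3) z'(2) by auto
        then show ?thesis using True r ne eq by metis
      next
        case False
        then have "T r = T r'" using eq R_cases r by blast
        then show ?thesis using trace_inj r by (auto simp: R_def)
      qed
    qed
    moreover have xR: "x \<notin> N r \<inter> S'" if "r \<in> R" for r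
      using xX that by (auto simp: R_def)
    ultimately have "inj_on (\<lambda>r. N r \<inter> S') (insert w R)"
      using wtrace by (intro inj_on_insertI) auto
    moreover have "N r \<inter> S' \<noteq> N s' \<inter> S'" if "r \<in> insert w R" for r
      using that wtrace s'trace xR[of r] t s' xw by auto
    ultimately have "inj_on (\<lambda>r. N r \<inter> S') (insert s' (insert w R))"
      by (rule inj_on_insertI)
    moreover have "N r \<inter> S' \<noteq> N s \<inter> S'" if "r \<in> insert s' (insert w R)" for r
      using that wtrace s'trace strace xR[of r] xz zw by auto
    ultimately show "inj_on (\<lambda>r. N r \<inter> S') (insert s (insert s' (insert w R)))"
      by (rule inj_on_insertI)
    fix r assume "r \<in> insert s (insert s' (insert w R))"
    then consider "r = s" | "r = s'" | "r \<in> insert w (X \<union> Z)" by (auto simp: R_def)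
    then show "\<not> S' \<subseteq> N r"
    proof cases
      case 1
      then show ?thesis using Ns t s' by (auto simp: S'_def)
    next
      case 2
      then show ?thesis using Ns' t s' by (auto simp: S'_def)
    next
      case 3
      then show ?thesis using pendant_not_adjacent_outside[OF z(1)] by (auto simp: S'_def)
    qed
  qed
qed

text \<open>Consider trading \<open>s\<close> for its pendant \<open>z\<close>. Then \<open>z\<close> marks \<open>s\<close>, and the one trace that changes by losing
  \<open>s\<close>, apart from that of \<open>w\<close>, is that of \<open>x\<close>. It can collide only with a pendant at the single other
  vertex of the trace of \<open>x\<close>, which is the situation of the previous lemma.\<close>

lemma no_pendant_beside_X:
  assumes x: "x \<in> X" "s \<in> T x" and z: "z \<in> Z" "T z = {s}"
  shows False
proof -
  have xw: "x \<in> N w" "x \<notin> S" "x \<in> pverts G" using x N_subset by (auto simp: X_def)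
  have zw: "z \<notin> N w" "z \<notin> S" "z \<noteq> w" "z \<in> pverts G" using z S_sub_Nw by (auto simp: Z_def)
  have sS: "s \<in> S" "s \<in> N x" "s \<in> N z" using x z by auto
  have xz: "x \<noteq> z" using xw zw by auto
  have "T x \<noteq> {s}" using trace_inj[of x z] x z xz by auto
  then have rest: "T x - {s} \<noteq> {}" using x by auto
  have not_full: "T x \<noteq> S" using trace_not_full x by auto
  have Ns: "N s \<inter> S = T x - {s}" by (rule neighbors_in_S) fact+
  have others: "v = x" if "v \<in> X" "t \<in> T v" "t \<in> T x" for v t
    using X_trace_disjoint that x by blast
  show False
  proof (cases "\<exists>s' z'. T x = {s, s'} \<and> s' \<noteq> s \<and> z' \<in> Z \<and> T z' = {s'}")
    case False
    define S' where "S' = insert z (S - {s})"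
    define R where "R = X \<union> Z - {z}"
    have Rtrace: "N r \<inter> S' = T r - {s}" if "r \<in> R" for r
      using that pendant_not_adjacent_outside[OF z(1), of r] by (auto simp: S'_def R_def)
    have wtrace: "N w \<inter> S' = S - {s}" using zw S_sub_Nw by (auto simp: S'_def)
    have strace: "N s \<inter> S' = insert z (T x - {s})"
      using Ns sS N_sym by (auto simp: S'_def)
    have sR: "r = x" if "r \<in> R" "s \<in> T r" for r
    proof (cases "r \<in> X")
      case True
      then show ?thesis using others[of r s] that x by auto
    next
      case False
      then have r: "r \<in> Z" "r \<noteq> z" using that by (auto simp: R_def)
      then obtain t where "T r = {t}" using trace_Z_singleton by metis
      then show ?thesis using that r z trace_inj[of r z] by auto
    qed
    have xR: "False" if r: "r \<in> R" "r \<noteq> x" and eq: "T r - {s} = T x - {s}" for r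
    proof -
      have "s \<notin> T r" using sR r by auto
      with eq have Tr: "T r = T x - {s}" by auto
      show False
      proof (cases "r \<in> X")
        case True
        then show ?thesis using others[of r] Tr rest r by auto
      next
        case False
        then have rZ: "r \<in> Z" using r by (auto simp: R_def)
        then obtain t where "T r = {t}" using trace_Z_singleton by metis
        then have "T x = {s, t} \<and> t \<noteq> s \<and> r \<in> Z \<and> T r = {t}" using Tr x rZ by auto
        then show ?thesis using \<open>\<not> (\<exists>s' z'. _ s' z')\<close> by blast
      qed
    qed
    show False
    proof (rule exchange_impossible[of S' "insert s (insert w R)"])
      show "S' \<subseteq> pverts G" using LD_set_subset[OF LD] zw by (auto simp: S'_def)
      show "card S' \<le> card S"
        using finite_S sS(1) zw card_Suc_Diff1[of S s] by (simp add: S'_def)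
      show "pverts G - S' = insert s (insert w R)"
        using outside sS(1) verts_eq zw w by (auto simp: S'_def R_def)
      have inj: "inj_on (\<lambda>r. N r \<inter> S') R"
      proof (rule inj_onI)
        fix r r' assume r: "r \<in> R" "r' \<in> R" and "N r \<inter> S' = N r' \<inter> S'"
        then have eq: "T r - {s} = T r' - {s}" using Rtrace by simp
        show "r = r'"
        proof (cases "r = x \<or> r' = x")
          case True
          then show ?thesis using xR[of r] xR[of r'] r eq by metis
        next
          case False
          then have "T r = T r'" using eq sR r by blast
          then show ?thesis using trace_inj r by (auto simp: R_def)
        qed
      qed
      have wR: "S - {s} \<noteq> T r - {s}" if r: "r \<in> R" for r
      proof
        assume eq: "S - {s} = T r - {s}"
        show False
        proof (cases "r = x")
          case True
          then show ?thesis using eq x not_full by auto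
        next
          case rx: False
          then have Tr: "T r = S - {s}" using eq sR r by auto
          show False
          proof (cases "r \<in> X")
            case True
            then show ?thesis using others[of r] Tr rest rx by blast
          next
            case False
            then obtain t where t: "T r = {t}" using trace_Z_singleton r by (auto simp: R_def)
            have "S = {s, t}" using Tr t sS by auto
            moreover have "T x - {s} \<subseteq> {t}" using Tr t by auto
            then have "t \<in> T x" using rest by auto
            ultimately have "T x = S" using x by auto
            then show False using not_full by auto
          qed
        qed
      qed
      have "N r \<inter> S' \<noteq> N w \<inter> S'" if "r \<in> R" for r
        using wR[OF that] Rtrace[OF that] wtrace by metis
      with inj have "inj_on (\<lambda>r. N r \<inter> S') (insert w R)"
        by (rule inj_on_insertI)
      moreover have "z \<notin> N r" if "r \<in> insert w R" for r
        using that pendant_not_adjacent_outside[OF z(1), of r] by (auto simp: R_def)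
      then have "N r \<inter> S' \<noteq> N s \<inter> S'" if "r \<in> insert w R" for r
        using that strace by blast
      ultimately show "inj_on (\<lambda>r. N r \<inter> S') (insert s (insert w R))" by (rule inj_on_insertI)
      fix r assume "r \<in> insert s (insert w R)"
      then consider "r = s" | "r \<in> insert w (X \<union> Z)" by (auto simp: R_def)
      then show "\<not> S' \<subseteq> N r"
      proof cases
        case 1
        then show ?thesis using Ns not_full x by (auto simp: S'_def)
      next
        case 2
        then show ?thesis using pendant_not_adjacent_outside[OF z(1)] by (auto simp: S'_def)
      qed
    qed
  next
    case True
    then show ?thesis using no_pendants_on_both_ends x z by blast
  qed
qed

end

section \<open>The four families\<close>

context pair_graph
begin

text \<open>The other inequality is \<open>location_domination_number_complement_le\<close>.\<close>

lemma location_domination_number_complement_eqI: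
  assumes "\<And>S. LD_set (complement G) S \<Longrightarrow> \<exists>S'. LD_set G S' \<and> card S' < card S"
  shows "location_domination_number (complement G) = location_domination_number G + 1"
proof -
  obtain S where S: "LD_set (complement G) S" "card S = location_domination_number (complement G)"
    using minimum_LD_set[of "complement G"] pair_finite_verts by auto
  obtain S' where "LD_set G S'" "card S' < card S" using assms[OF S(1)] by blast
  then have "location_domination_number G < location_domination_number (complement G)"
    using location_domination_number_le[OF pair_finite_verts] S(2) by fastforce
  then show ?thesis using location_domination_number_complement_le by simp
qed

text \<open>The graph \<open>K\<^sub>1 \<or> (K\<^sub>1 + K\<^sub>r)\<close>, in which the first \<open>K\<^sub>1\<close> is \<open>c\<close>, the second is \<open>p\<close>, and \<open>K\<close> is the
  vertex set of \<open>K\<^sub>r\<close>.\<close>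

definition clique_with_pendant :: "'a \<Rightarrow> 'a \<Rightarrow> 'a set \<Rightarrow> bool" where
  "clique_with_pendant c p K \<longleftrightarrow> pverts G = insert c (insert p K) \<and>
     c \<notin> K \<and> p \<notin> K \<and> c \<noteq> p \<and> card K \<ge> 2 \<and>
     N c = insert p K \<and> N p = {c} \<and> (\<forall>u\<in>K. N u = insert c (K - {u}))"

text \<open>The path \<open>p q\<close> joined by the edge \<open>q c\<close> to the complete graph on \<open>K\<close> and \<open>c\<close>.\<close>

definition clique_with_tail :: "'a \<Rightarrow> 'a \<Rightarrow> 'a \<Rightarrow> 'a set \<Rightarrow> bool" where
  "clique_with_tail c q p K \<longleftrightarrow> pverts G = {p, q, c} \<union> K \<and>
     distinct [p, q, c] \<and> K \<inter> {p, q, c} = {} \<and> card K \<ge> 2 \<and>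
     N c = insert q K \<and> N q = {p, c} \<and> N p = {q} \<and> (\<forall>u\<in>K. N u = insert c (K - {u}))"

text \<open>At least two cliques of order at least three glued at \<open>c\<close>. Transitivity of adjacency makes the
  components of \<open>N c\<close> cliques, the conjunct before it excludes singletons, and the last one says that
  there is more than one component.\<close>

definition windmill :: "'a \<Rightarrow> bool" where
  "windmill c \<longleftrightarrow> c \<in> pverts G \<and> N c = pverts G - {c} \<and>
     (\<forall>a\<in>N c. N a \<inter> N c \<noteq> {}) \<and>
     (\<forall>a\<in>N c. \<forall>b\<in>N a \<inter> N c. \<forall>d\<in>N b \<inter> N c. d \<noteq> a \<longrightarrow> d \<in> N a) \<and>
     (\<exists>a\<in>N c. \<exists>b\<in>N c. a \<noteq> b \<and> b \<notin> N a)"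

text \<open>The complement has no edges, so only the set of all vertices dominates it.\<close>

lemma complete_number:
  assumes "card (pverts G) \<ge> 2" "\<And>v. v \<in> pverts G \<Longrightarrow> N v = pverts G - {v}"
  shows "location_domination_number (complement G) = location_domination_number G + 1"
proof (rule location_domination_number_complement_eqI)
  fix S assume S: "LD_set (complement G) S"
  have "S = pverts G"
  proof (rule ccontr)
    assume "S \<noteq> pverts G"
    then obtain u where u: "u \<in> pverts G - S" using S by (auto simp: LD_set_complement_iff)
    then have "\<not> S \<subseteq> N u" "S \<subseteq> pverts G" using S by (auto simp: LD_set_complement_iff)
    then show False using assms(2)[of u] u by auto
  qed
  obtain v where v: "v \<in> pverts G" using assms(1) by fastforce
  have "N v \<inter> (pverts G - {v}) \<noteq> {}"
  proof
    assume "N v \<inter> (pverts G - {v}) = {}"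
    then have "pverts G = {v}" using assms(2)[OF v] v by auto
    then show False using assms(1) by simp
  qed
  moreover have "pverts G - (pverts G - {v}) = {v}" using v by auto
  ultimately have "LD_set G (pverts G - {v})" by (auto simp: LD_set_iff)
  moreover have "card (pverts G - {v}) < card S"
    using card_Diff1_less[OF pair_finite_verts v] \<open>S = pverts G\<close> by simp
  ultimately show "\<exists>S'. LD_set G S' \<and> card S' < card S" by blast
qed

text \<open>In the complement \<open>c\<close> is isolated and lies in every LD-set \<open>S\<close>. In \<open>G\<close> it can be dropped from \<open>S\<close>: all
  other outside vertices are adjacent to \<open>c\<close>, so their traces stay distinct, and \<open>c\<close> is the only one
  with a full trace. A trace that was only \<open>{c}\<close> would be shared with a neighbor in \<open>N c\<close>.\<close>

lemma windmill_number:
  assumes "windmill c"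
  shows "location_domination_number (complement G) = location_domination_number G + 1"
proof (rule location_domination_number_complement_eqI)
  fix S assume S: "LD_set (complement G) S"
  have c: "c \<in> pverts G" "N c = pverts G - {c}" and nbr: "\<And>a. a \<in> N c \<Longrightarrow> N a \<inter> N c \<noteq> {}"
    and trans: "\<And>a b d. a \<in> N c \<Longrightarrow> b \<in> N a \<inter> N c \<Longrightarrow> d \<in> N b \<inter> N c \<Longrightarrow> d \<noteq> a \<Longrightarrow> d \<in> N a"
    using assms unfolding windmill_def by metis+
  have sub: "S \<subseteq> pverts G" and inj: "inj_on (\<lambda>v. N v \<inter> S) (pverts G - S)"
    and not_full: "\<And>v. v \<in> pverts G - S \<Longrightarrow> \<not> S \<subseteq> N v"
    using S by (auto simp: LD_set_complement_iff)
  have cS: "c \<in> S" using not_full[of c] c sub by auto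
  have out: "v \<in> N c" "c \<in> N v" if "v \<in> pverts G - S" for v
    using that c cS N_sym by auto
  have "LD_set G (S - {c})"
    unfolding LD_set_iff
  proof (intro conjI ballI)
    show "S - {c} \<subseteq> pverts G" using sub by auto
    have eq: "pverts G - (S - {c}) = insert c (pverts G - S)" using c by auto
    have Nc: "N c \<inter> (S - {c}) = S - {c}" using c sub by auto
    have "inj_on (\<lambda>v. N v \<inter> (S - {c})) (pverts G - S)"
    proof (rule inj_onI)
      fix u v assume uv: "u \<in> pverts G - S" "v \<in> pverts G - S"
        and "N u \<inter> (S - {c}) = N v \<inter> (S - {c})"
      then have "N u \<inter> S = N v \<inter> S" using out by blast
      then show "u = v" using inj uv by (auto dest: inj_onD)
    qed
    moreover have "N v \<inter> (S - {c}) \<noteq> N c \<inter> (S - {c})" if "v \<in> pverts G - S" for v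
      using not_full[OF that] out[OF that] Nc by blast
    ultimately show "inj_on (\<lambda>v. N v \<inter> (S - {c})) (pverts G - (S - {c}))"
      unfolding eq by (rule inj_on_insertI)
    fix v assume "v \<in> pverts G - (S - {c})"
    then consider "v = c" | "v \<in> pverts G - S" by auto
    then show "N v \<inter> (S - {c}) \<noteq> {}"
    proof cases
      case 1
      obtain a where "a \<in> N c" using assms by (auto simp: windmill_def)
      then have "S \<noteq> {c}" using not_full[of a] c N_sym by auto
      then show ?thesis using 1 Nc cS by auto
    next
      case 2
      obtain b where b: "b \<in> N v" "b \<in> N c" using nbr[of v] out[OF 2] by auto
      show ?thesis
      proof (cases "b \<in> S")
        case True
        moreover have "b \<noteq> c" using b(2) by auto
        ultimately show ?thesis using b(1) by blast
      next
        case False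
        have bout: "b \<in> pverts G - S" using False b c by auto
        show ?thesis
        proof
          assume "N v \<inter> (S - {c}) = {}"
          then have Nv: "N v \<inter> S = {c}" using out[OF 2] cS by blast
          have only_c: "t = c" if "t \<in> N b" "t \<in> S" for t
          proof (rule ccontr)
            assume "t \<noteq> c"
            then have "t \<in> N c" "t \<noteq> v" using that c(2) sub 2 by auto
            then have "t \<in> N v" using trans[of v b t] that out[OF 2] b by auto
            then show False using Nv that \<open>t \<noteq> c\<close> by auto
          qed
          have "c \<in> N b \<inter> S" using out(2)[OF bout] cS by simp
          then have "N b \<inter> S = {c}" using only_c by auto
          then have "N b \<inter> S = N v \<inter> S" using Nv by simp
          then have "b = v" using inj_onD[OF inj _ bout 2] by simp
          then show False using b by simp
        qed
      qed
    qed
  qed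
  moreover have "card (S - {c}) < card S"
    using card_Diff1_less[OF finite_subset[OF sub pair_finite_verts] cS] .
  ultimately show "\<exists>S'. LD_set G S' \<and> card S' < card S" by blast
qed

text \<open>Again \<open>c\<close> is isolated in the complement. If \<open>p\<close> is in \<open>S\<close>, then \<open>c\<close> can be dropped in \<open>G\<close>, where \<open>p\<close> marks
  it. Otherwise a vertex of \<open>K\<close> outside \<open>S\<close> would have a full trace in \<open>G\<close>, so \<open>S\<close> contains all vertices
  but \<open>p\<close>, and a vertex of \<open>K\<close> can be dropped.\<close>

lemma clique_with_pendant_number:
  assumes "clique_with_pendant c p K"
  shows "location_domination_number (complement G) = location_domination_number G + 1"
proof (rule location_domination_number_complement_eqI)
  fix S assume S: "LD_set (complement G) S"
  have V: "pverts G = insert c (insert p K)" "c \<notin> K" "p \<notin> K" "c \<noteq> p"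
    and nbrs: "N c = insert p K" "N p = {c}" "\<And>u. u \<in> K \<Longrightarrow> N u = insert c (K - {u})"
    and cardK: "card K \<ge> 2"
    using assms by (auto simp: clique_with_pendant_def)
  have another: "\<exists>u\<in>K. u \<noteq> v" for v
  proof (rule ccontr)
    assume "\<not> (\<exists>u\<in>K. u \<noteq> v)"
    then have "K \<subseteq> {v}" by auto
    then show False using cardK card_mono[of "{v}" K] by auto
  qed
  have sub: "S \<subseteq> pverts G" and inj: "inj_on (\<lambda>v. N v \<inter> S) (pverts G - S)"
    and not_full: "\<And>v. v \<in> pverts G - S \<Longrightarrow> \<not> S \<subseteq> N v"
    using S by (auto simp: LD_set_complement_iff)
  have fin: "finite S" by (rule finite_subset[OF sub pair_finite_verts])
  have cS: "c \<in> S"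
  proof (rule ccontr)
    assume "c \<notin> S"
    then have "S \<subseteq> N c" "c \<in> pverts G - S" using nbrs(1) V sub by auto
    then show False using not_full by blast
  qed
  show "\<exists>S'. LD_set G S' \<and> card S' < card S"
  proof (cases "p \<in> S")
    case True
    have out: "v \<in> K" if "v \<in> pverts G - S" for v using that V cS True by auto
    have "LD_set G (S - {c})"
      unfolding LD_set_iff
    proof (intro conjI ballI)
      show "S - {c} \<subseteq> pverts G" using sub by auto
      have eq: "pverts G - (S - {c}) = insert c (pverts G - S)" using V by auto
      have "inj_on (\<lambda>v. N v \<inter> (S - {c})) (pverts G - S)"
      proof (rule inj_onI)
        fix u v assume uv: "u \<in> pverts G - S" "v \<in> pverts G - S"
          and "N u \<inter> (S - {c}) = N v \<inter> (S - {c})"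
        moreover have "c \<in> N u" "c \<in> N v" using nbrs(3) out uv by auto
        ultimately have "N u \<inter> S = N v \<inter> S" by blast
        then show "u = v" using inj uv by (auto dest: inj_onD)
      qed
      moreover have "N v \<inter> (S - {c}) \<noteq> N c \<inter> (S - {c})" if "v \<in> pverts G - S" for v
        using nbrs(3)[OF out[OF that]] nbrs(1) True V by auto
      ultimately show "inj_on (\<lambda>v. N v \<inter> (S - {c})) (pverts G - (S - {c}))"
        unfolding eq by (rule inj_on_insertI)
      fix v assume "v \<in> pverts G - (S - {c})"
      then consider "v = c" | "v \<in> pverts G - S" by auto
      then show "N v \<inter> (S - {c}) \<noteq> {}"
      proof cases
        case 1
        then show ?thesis using True nbrs(1) V by auto
      next
        case 2
        obtain u where u: "u \<in> K" "u \<noteq> v" using another by blast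
        have "u \<in> S"
        proof (rule ccontr)
          assume "u \<notin> S"
          then have "N u \<inter> S = N v \<inter> S" using nbrs(3)[OF u(1)] nbrs(3)[OF out[OF 2]] 2 by auto
          then show False using inj 2 u \<open>u \<notin> S\<close> V by (auto dest: inj_onD)
        qed
        then show ?thesis using u nbrs(3)[OF out[OF 2]] V by auto
      qed
    qed
    moreover have "card (S - {c}) < card S" using card_Diff1_less[OF fin cS] .
    ultimately show ?thesis by blast
  next
    case False
    have "K \<subseteq> S"
    proof
      fix v assume "v \<in> K"
      then show "v \<in> S" using not_full[of v] nbrs(3)[of v] sub V False by auto
    qed
    then have S_eq: "S = insert c K" using sub V False cS by auto
    obtain x where x: "x \<in> K" using another by blast
    obtain y where y: "y \<in> K" "y \<noteq> x" using another by blast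
    have out: "pverts G - (S - {x}) = {p, x}" using S_eq x V by auto
    have tr: "N p \<inter> (S - {x}) = {c}" "N x \<inter> (S - {x}) = insert c (K - {x})"
      using nbrs(2) nbrs(3)[OF x] S_eq x V by auto
    have "LD_set G (S - {x})"
      unfolding LD_set_iff out using tr y sub V by (auto simp: inj_on_def)
    moreover have "card (S - {x}) < card S" using S_eq x by (intro card_Diff1_less[OF fin]) auto
    ultimately show ?thesis by blast
  qed
qed

text \<open>In \<open>G\<close> there is an LD-set of the size of \<open>K\<close>: \<open>q\<close> and all but one vertex of \<open>K\<close>. An LD-set of the
  complement is larger: it misses at most one vertex of \<open>K\<close>, as these are twins; if it misses none, it
  contains \<open>c\<close> or, to dominate \<open>c\<close>, it contains \<open>p\<close>; and if it misses one, it contains two of \<open>p\<close>, \<open>q\<close>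
  and \<open>c\<close>.\<close>

lemma clique_with_tail_number:
  assumes "clique_with_tail c q p K"
  shows "location_domination_number (complement G) = location_domination_number G + 1"
proof (rule location_domination_number_complement_eqI)
  fix S assume S: "LD_set (complement G) S"
  have V: "pverts G = {p, q, c} \<union> K" "c \<notin> K" "p \<notin> K" "q \<notin> K" "c \<noteq> p" "c \<noteq> q" "p \<noteq> q"
    and nbrs: "N c = insert q K" "N q = {p, c}" "N p = {q}" "\<And>u. u \<in> K \<Longrightarrow> N u = insert c (K - {u})"
    and cardK: "card K \<ge> 2"
    using assms by (auto simp: clique_with_tail_def)
  have finK: "finite K" using V(1) pair_finite_verts by (auto intro: finite_subset)
  have sub: "S \<subseteq> pverts G" and inj: "inj_on (\<lambda>v. N v \<inter> S) (pverts G - S)"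
    and not_full: "\<And>v. v \<in> pverts G - S \<Longrightarrow> \<not> S \<subseteq> N v"
    using S by (auto simp: LD_set_complement_iff)
  have fin: "finite S" by (rule finite_subset[OF sub pair_finite_verts])
  have large: "card K < card S"
  proof (cases "K \<subseteq> S")
    case True
    have "c \<in> S \<or> p \<in> S"
    proof (rule ccontr)
      assume "\<not> ?thesis"
      then show False using not_full[of c] nbrs(1) V sub by auto
    qed
    then obtain a where "a \<in> S" "a \<notin> K" using V by auto
    then have "K \<subset> S" using True by auto
    then show ?thesis using fin by (rule psubset_card_mono[rotated])
  next
    case False
    then obtain x where x: "x \<in> K" "x \<notin> S" by auto
    have rest: "u \<in> S" if "u \<in> K" "u \<noteq> x" for u
    proof (rule ccontr)
      assume "u \<notin> S"
      then have "N u \<inter> S = N x \<inter> S" using nbrs(4)[OF that(1)] nbrs(4)[OF x(1)] x by auto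
      then show False using inj x that \<open>u \<notin> S\<close> V by (auto dest: inj_onD)
    qed
    have pq: "p \<in> S \<or> q \<in> S"
    proof (rule ccontr)
      assume "\<not> ?thesis"
      then show False using not_full[of x] nbrs(4)[OF x(1)] x V sub by auto
    qed
    have "\<exists>a b. a \<in> S - K \<and> b \<in> S - K \<and> a \<noteq> b"
    proof (cases "c \<in> S")
      case True
      then show ?thesis using pq V by blast
    next
      case c: False
      have "q \<in> S"
      proof (rule ccontr)
        assume "q \<notin> S"
        then have "N c \<inter> S = N x \<inter> S" using nbrs(1) nbrs(4)[OF x(1)] x c by auto
        then show False using inj c x V by (auto dest: inj_onD)
      qed
      moreover have "p \<in> S"
      proof (rule ccontr)
        assume "p \<notin> S"
        then show False using not_full[of c] nbrs(1) c V sub by auto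
      qed
      ultimately show ?thesis using V by blast
    qed
    then obtain a b where ab: "a \<in> S - K" "b \<in> S - K" "a \<noteq> b" by blast
    have "card (insert a (insert b (K - {x}))) = Suc (card K)"
      using ab finK x card_Suc_Diff1[of K x] by simp
    moreover have "insert a (insert b (K - {x})) \<subseteq> S" using ab rest by auto
    ultimately show ?thesis using card_mono[OF fin, of "insert a (insert b (K - {x}))"] by simp
  qed
  obtain x where x: "x \<in> K" using cardK by fastforce
  have "K - {x} \<noteq> {}"
  proof
    assume "K - {x} = {}"
    then have "K = {x}" using x by auto
    then show False using cardK by simp
  qed
  then obtain y where y: "y \<in> K" "y \<noteq> x" by auto
  define S' where "S' = insert q (K - {x})"
  have out: "pverts G - S' = {p, c, x}" using x V by (auto simp: S'_def)
  have tr: "N p \<inter> S' = {q}" "N c \<inter> S' = S'" "N x \<inter> S' = K - {x}"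
    using nbrs(1-3) nbrs(4)[OF x] x V by (auto simp: S'_def)
  have "q \<in> S'" "y \<in> S'" "q \<notin> K - {x}" "y \<in> K - {x}" "y \<noteq> q" using y V by (auto simp: S'_def)
  then have "S' \<noteq> {q}" "K - {x} \<noteq> {q}" "S' \<noteq> K - {x}" "S' \<noteq> {}" "K - {x} \<noteq> {}" by blast+
  note ne = this
  have "inj_on (\<lambda>v. N v \<inter> S') {p, c, x}"
  proof (rule inj_onI)
    fix u v assume "u \<in> {p, c, x}" "v \<in> {p, c, x}" "N u \<inter> S' = N v \<inter> S'"
    then show "u = v" by (elim insertE emptyE) (use tr ne in metis)+
  qed
  moreover have "N v \<inter> S' \<noteq> {}" if "v \<in> {p, c, x}" for v
    using that by (elim insertE emptyE) (use tr ne in \<open>metis insert_not_empty\<close>)+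
  moreover have "S' \<subseteq> pverts G" using V by (auto simp: S'_def)
  ultimately have "LD_set G S'"
    unfolding LD_set_iff out by blast
  moreover have "card S' = card K"
    using V finK x card_Suc_Diff1[of K x] by (simp add: S'_def)
  ultimately show "\<exists>S'. LD_set G S' \<and> card S' < card S" using large by auto
qed

end

section \<open>Recognizing the families up to isomorphism\<close>

text \<open>The bijection goes from the model \<open>H\<close> to \<open>G\<close>, so that the named vertices of a family are images of
  concrete vertices of \<open>H\<close>.\<close>

lemma (in pair_graph) isomorphic_iff:
  assumes "parcs H \<subseteq> pverts H \<times> pverts H"
  shows "isomorphic G H \<longleftrightarrow> (\<exists>g. bij_betw g (pverts H) (pverts G) \<and>
    (\<forall>x\<in>pverts H. \<forall>y\<in>pverts H. (x, y) \<in> parcs H \<longleftrightarrow> g y \<in> N (g x)))"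
proof
  assume "isomorphic G H"
  then have "digraph_iso (with_proj H) (with_proj G)"
    unfolding isomorphic_def using digraph_iso_swap wf_digraph_axioms by blast
  then obtain f where f: "pre_digraph.digraph_isomorphism (with_proj H) f"
    and app: "with_proj G = app_iso f (with_proj H)"
    by (auto simp: digraph_iso_def)
  let ?g = "iso_verts f"
  have inj: "inj_on ?g (pverts H)"
    and arc: "\<And>e. e \<in> parcs H \<Longrightarrow> iso_tail f (iso_arcs f e) = ?g (fst e) \<and>
      iso_head f (iso_arcs f e) = ?g (snd e)"
    using f by (auto simp: pre_digraph.digraph_isomorphism_def)
  have G: "pverts G = ?g ` pverts H" "parcs G = iso_arcs f ` parcs H" "fst = iso_tail f" "snd = iso_head f"
    using arg_cong[OF app, of verts] arg_cong[OF app, of arcs] arg_cong[OF app, of tail]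
      arg_cong[OF app, of head] by simp_all
  have arcs: "iso_arcs f e = (?g (fst e), ?g (snd e))" if "e \<in> parcs H" for e
    using arc[OF that] unfolding G(3,4)[symmetric] by (simp add: prod_eq_iff)
  have "(x, y) \<in> parcs H \<longleftrightarrow> (?g x, ?g y) \<in> parcs G" if "x \<in> pverts H" "y \<in> pverts H" for x y
  proof
    assume "(?g x, ?g y) \<in> parcs G"
    then obtain e where e: "e \<in> parcs H" "?g x = ?g (fst e)" "?g y = ?g (snd e)"
      using G(2) arcs by auto
    moreover have "fst e \<in> pverts H" "snd e \<in> pverts H" using e(1) assms by auto
    ultimately have "x = fst e" "y = snd e" using that inj by (auto dest: inj_onD)
    then show "(x, y) \<in> parcs H" using e by simp
  qed (use G(2) arcs in force)
  then show "\<exists>g. bij_betw g (pverts H) (pverts G) \<and>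
    (\<forall>x\<in>pverts H. \<forall>y\<in>pverts H. (x, y) \<in> parcs H \<longleftrightarrow> g y \<in> N (g x))"
    using inj G(1) by (intro exI[of _ ?g]) (auto simp: bij_betw_def neighborhood_def)
next
  assume "\<exists>g. bij_betw g (pverts H) (pverts G) \<and>
    (\<forall>x\<in>pverts H. \<forall>y\<in>pverts H. (x, y) \<in> parcs H \<longleftrightarrow> g y \<in> N (g x))"
  then obtain g where g: "bij_betw g (pverts H) (pverts G)"
    and arc: "\<And>x y. x \<in> pverts H \<Longrightarrow> y \<in> pverts H \<Longrightarrow> (x, y) \<in> parcs H \<longleftrightarrow> (g x, g y) \<in> parcs G"
    by (auto simp: neighborhood_def)
  interpret H: wf_digraph "with_proj H" using assms by unfold_locales auto
  let ?f = "\<lparr>iso_verts = g, iso_arcs = map_prod g g, iso_head = snd, iso_tail = fst\<rparr>"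
  have inj: "inj_on g (pverts H)" and img: "g ` pverts H = pverts G"
    using g by (auto simp: bij_betw_def)
  have "inj_on (map_prod g g) (parcs H)"
    using map_prod_inj_on[OF inj inj] assms by (rule inj_on_subset)
  then have "pre_digraph.digraph_isomorphism (with_proj H) ?f"
    using inj H.wf_digraph_axioms by (auto simp: pre_digraph.digraph_isomorphism_def)
  moreover have "map_prod g g ` parcs H = parcs G"
  proof
    show "map_prod g g ` parcs H \<subseteq> parcs G" using arc assms by force
    show "parcs G \<subseteq> map_prod g g ` parcs H"
    proof
      fix e assume e: "e \<in> parcs G"
      then have "fst e \<in> g ` pverts H" "snd e \<in> g ` pverts H"
        unfolding img using arc_fst_in_verts arc_snd_in_verts by auto
      then obtain x y where xy: "x \<in> pverts H" "y \<in> pverts H" "e = (g x, g y)"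
        by (metis imageE prod.collapse)
      then have "(x, y) \<in> parcs H" using arc e by simp
      then show "e \<in> map_prod g g ` parcs H" using xy(3) by force
    qed
  qed
  then have "with_proj G = app_iso ?f (with_proj H)"
    using img by (intro pre_digraph.equality) simp_all
  ultimately have "digraph_iso (with_proj H) (with_proj G)" by (auto simp: digraph_iso_def)
  then show "isomorphic G H"
    unfolding isomorphic_def by (rule digraph_iso_swap[OF H.wf_digraph_axioms])
qed

lemmas construction_defs = complete_graph_def disjoint_union_def indexed_disjoint_union_def
  graph_join_def join_by_edge_def

context pair_graph
begin

lemma N_image:
  assumes "bij_betw g (pverts H) (pverts G)"
    and "\<And>x y. x \<in> pverts H \<Longrightarrow> y \<in> pverts H \<Longrightarrow> (x, y) \<in> parcs H \<longleftrightarrow> g y \<in> N (g x)"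
    and "x \<in> pverts H"
  shows "N (g x) = g ` {y \<in> pverts H. (x, y) \<in> parcs H}"
proof (intro equalityI subsetI)
  fix v assume v: "v \<in> N (g x)"
  then have "v \<in> g ` pverts H" using N_subset assms(1) by (auto simp: bij_betw_def)
  then obtain y where "y \<in> pverts H" "v = g y" by auto
  then show "v \<in> g ` {y \<in> pverts H. (x, y) \<in> parcs H}"
    using v assms(2)[OF assms(3)] by blast
next
  fix v assume "v \<in> g ` {y \<in> pverts H. (x, y) \<in> parcs H}"
  then show "v \<in> N (g x)" using assms(2)[OF assms(3)] by blast
qed

lemma isomorphic_complete_graph_iff:
  "isomorphic G (complete_graph n) \<longleftrightarrow>
    card (pverts G) = n \<and> (\<forall>v\<in>pverts G. N v = pverts G - {v})"
proof -
  let ?H = "complete_graph n"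
  have wf: "parcs ?H \<subseteq> pverts ?H \<times> pverts ?H" by (auto simp: complete_graph_def)
  show ?thesis
  proof
    assume "isomorphic G ?H"
    then obtain g where g: "bij_betw g (pverts ?H) (pverts G)"
      and adj: "\<And>x y. x \<in> pverts ?H \<Longrightarrow> y \<in> pverts ?H \<Longrightarrow> (x, y) \<in> parcs ?H \<longleftrightarrow> g y \<in> N (g x)"
      unfolding isomorphic_iff[OF wf] by blast
    have inj: "inj_on g {..<n}" and V: "pverts G = g ` {..<n}"
      using g by (auto simp: bij_betw_def complete_graph_def)
    have "N v = pverts G - {v}" if v: "v \<in> pverts G" for v
    proof -
      obtain i where i: "i < n" "v = g i" using v V by auto
      have "{y \<in> pverts ?H. (i, y) \<in> parcs ?H} = {..<n} - {i}"
        using i by (auto simp: complete_graph_def)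
      then have "N v = g ` ({..<n} - {i})"
        using N_image[OF g adj, of i] i by (simp add: complete_graph_def)
      also have "\<dots> = pverts G - {v}"
        using inj_on_image_set_diff[OF inj, of "{..<n}" "{i}"] i V by auto
      finally show ?thesis .
    qed
    then show "card (pverts G) = n \<and> (\<forall>v\<in>pverts G. N v = pverts G - {v})"
      using V card_image[OF inj] by simp
  next
    assume *: "card (pverts G) = n \<and> (\<forall>v\<in>pverts G. N v = pverts G - {v})"
    then obtain g where g: "bij_betw g {0..<n} (pverts G)"
      using ex_bij_betw_nat_finite[OF pair_finite_verts] by auto
    then have "bij_betw g (pverts ?H) (pverts G)"
      by (simp add: complete_graph_def lessThan_atLeast0)
    moreover have "(x, y) \<in> parcs ?H \<longleftrightarrow> g y \<in> N (g x)" if "x \<in> pverts ?H" "y \<in> pverts ?H" for x y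
    proof -
      have "x \<in> {0..<n}" "y \<in> {0..<n}" using that by (auto simp: complete_graph_def)
      then have "g x \<in> pverts G" "g y \<in> pverts G" "g x = g y \<longleftrightarrow> x = y"
        using g by (auto simp: bij_betw_def dest: inj_onD)
      then show ?thesis using * that by (auto simp: complete_graph_def)
    qed
    ultimately show "isomorphic G ?H" unfolding isomorphic_iff[OF wf] by blast
  qed
qed

lemma isomorphic_clique_with_pendant_iff:
  assumes "r \<ge> 2"
  shows "isomorphic G (graph_join (complete_graph 1) (disjoint_union (complete_graph 1) (complete_graph r)))
    \<longleftrightarrow> (\<exists>c p K. clique_with_pendant c p K \<and> card K = r)"
proof -
  define H where "H = graph_join (complete_graph 1) (disjoint_union (complete_graph 1) (complete_graph r))"
  have wf: "parcs H \<subseteq> pverts H \<times> pverts H" by (auto simp: H_def construction_defs)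
  have verts: "pverts H = insert (Inl 0) (insert (Inr (Inl 0)) (Inr ` Inr ` {..<r}))"
    by (auto simp: H_def construction_defs)
  have arcs: "(Inl 0, y) \<in> parcs H \<longleftrightarrow> y = Inr (Inl 0) \<or> y \<in> Inr ` Inr ` {..<r}"
    "(Inr (Inl 0), y) \<in> parcs H \<longleftrightarrow> y = Inl 0"
    "i < r \<Longrightarrow> (Inr (Inr i), y) \<in> parcs H \<longleftrightarrow> y = Inl 0 \<or> y \<in> Inr ` Inr ` ({..<r} - {i})" for i y
    by (auto simp: H_def construction_defs)
  have mem: "Inl 0 \<in> pverts H" "Inr (Inl 0) \<in> pverts H" "\<And>i. i < r \<Longrightarrow> Inr (Inr i) \<in> pverts H"
    by (simp_all add: verts)
  show ?thesis
    unfolding H_def[symmetric]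
  proof
    assume "isomorphic G H"
    then obtain g where g: "bij_betw g (pverts H) (pverts G)"
      and adj: "\<And>x y. x \<in> pverts H \<Longrightarrow> y \<in> pverts H \<Longrightarrow> (x, y) \<in> parcs H \<longleftrightarrow> g y \<in> N (g x)"
      unfolding isomorphic_iff[OF wf] by blast
    define c p h where "c = g (Inl 0)" and "p = g (Inr (Inl 0))" and "h = (\<lambda>i. g (Inr (Inr i)))"
    note defs = c_def p_def h_def
    have img: "pverts G = g ` pverts H"
      and ginj: "\<And>x y. x \<in> pverts H \<Longrightarrow> y \<in> pverts H \<Longrightarrow> g x = g y \<longleftrightarrow> x = y"
      using g by (auto simp: bij_betw_def inj_on_eq_iff)
    have injh: "inj_on h {..<r}" and cp: "c \<noteq> p" "c \<notin> h ` {..<r}" "p \<notin> h ` {..<r}"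
      by (auto simp: inj_on_def defs ginj mem)
    have V: "pverts G = insert c (insert p (h ` {..<r}))"
      by (simp add: img verts defs image_image)
    have "{y \<in> pverts H. (Inl 0, y) \<in> parcs H} = insert (Inr (Inl 0)) (Inr ` Inr ` {..<r})"
      by (auto simp: arcs mem)
    then have "N c = insert p (h ` {..<r})"
      using N_image[OF g adj mem(1)] by (simp add: defs image_image)
    moreover have "{y \<in> pverts H. (Inr (Inl 0), y) \<in> parcs H} = {Inl 0}"
      by (auto simp: arcs mem)
    then have "N p = {c}"
      using N_image[OF g adj mem(2)] by (simp add: defs)
    moreover have "N u = insert c (h ` {..<r} - {u})" if "u \<in> h ` {..<r}" for u
    proof -
      from that obtain i where i: "i \<in> {..<r}" "u = h i" by (rule imageE)
      have "{y \<in> pverts H. (Inr (Inr i), y) \<in> parcs H} = insert (Inl 0) (Inr ` Inr ` ({..<r} - {i}))"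
        using i(1) by (auto simp: arcs mem)
      then have "N u = insert c (h ` ({..<r} - {i}))"
        using N_image[OF g adj mem(3)[of i]] i by (simp add: defs image_image)
      also have "h ` ({..<r} - {i}) = h ` {..<r} - {u}"
        using inj_on_image_set_diff[OF injh, of "{..<r}" "{i}"] i by simp
      finally show ?thesis .
    qed
    moreover have "card (h ` {..<r}) = r" using card_image[OF injh] by simp
    ultimately have "clique_with_pendant c p (h ` {..<r}) \<and> card (h ` {..<r}) = r"
      using V cp assms by (simp add: clique_with_pendant_def)
    then show "\<exists>c p K. clique_with_pendant c p K \<and> card K = r" by blast
  next
    assume "\<exists>c p K. clique_with_pendant c p K \<and> card K = r"
    then obtain c p K where *: "clique_with_pendant c p K" and r: "card K = r" by blast
    then have V: "pverts G = insert c (insert p K)" and ne: "c \<notin> K" "p \<notin> K" "c \<noteq> p"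
      and nbrs: "N c = insert p K" "N p = {c}" "\<And>u. u \<in> K \<Longrightarrow> N u = insert c (K - {u})"
      by (auto simp: clique_with_pendant_def)
    have "finite K" using V pair_finite_verts by (auto intro: finite_subset)
    then obtain h where "bij_betw h {0..<r} K" using ex_bij_betw_nat_finite r by blast
    then have h: "inj_on h {..<r}" "h ` {..<r} = K" by (auto simp: bij_betw_def lessThan_atLeast0)
    define g :: "nat + nat + nat \<Rightarrow> 'a" where "g = case_sum (\<lambda>_. c) (case_sum (\<lambda>_. p) h)"
    have gs: "g (Inl 0) = c" "g (Inr (Inl 0)) = p" "g (Inr (Inr i)) = h i" for i
      by (auto simp: g_def)
    have hK: "h i \<in> K" "h i \<noteq> c" "h i \<noteq> p" if "i < r" for i using h(2) that ne by auto
    have hinj: "h i = h j \<longleftrightarrow> i = j" if "i < r" "j < r" for i j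
      using h(1) that by (auto simp: inj_on_eq_iff)
    have "bij_betw g (pverts H) (pverts G)"
    proof (rule bij_betw_imageI)
      have "inj_on g (Inr ` Inr ` {..<r})" by (auto simp: inj_on_def gs hinj)
      then show "inj_on g (pverts H)"
        unfolding verts using ne hK by (intro inj_on_insertI) (auto simp: gs)
      show "g ` pverts H = pverts G"
        by (simp add: verts V gs image_image h(2))
    qed
    moreover have "(x, y) \<in> parcs H \<longleftrightarrow> g y \<in> N (g x)" if xy: "x \<in> pverts H" "y \<in> pverts H" for x y
    proof -
      have y: "y = Inl 0 \<or> y = Inr (Inl 0) \<or> (\<exists>j<r. y = Inr (Inr j))" using xy verts by auto
      have "x = Inl 0 \<or> x = Inr (Inl 0) \<or> (\<exists>i<r. x = Inr (Inr i))" using xy verts by auto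
      then show ?thesis
        using y by (elim disjE exE conjE) (use ne hK hinj in \<open>auto simp: arcs gs nbrs(1,2) nbrs(3)[OF hK(1)]\<close>)
    qed
    ultimately show "isomorphic G H" unfolding isomorphic_iff[OF wf] by blast
  qed
qed

lemma isomorphic_clique_with_tail_iff:
  assumes "r \<ge> 2"
  shows "isomorphic G (join_by_edge (complete_graph 2) 0 (complete_graph (r + 1)) 0)
    \<longleftrightarrow> (\<exists>c q p K. clique_with_tail c q p K \<and> card K = r)"
proof -
  define H where "H = join_by_edge (complete_graph 2) 0 (complete_graph (r + 1)) 0"
  let ?k = "\<lambda>i. Inr (Suc i) :: nat + nat"
  have wf: "parcs H \<subseteq> pverts H \<times> pverts H" by (auto simp: H_def construction_defs)
  have less: "{..<2} = {0, Suc 0}" by auto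
  have verts: "pverts H = insert (Inl (Suc 0)) (insert (Inl 0) (insert (Inr 0) (?k ` {..<r})))"
    by (auto simp: H_def construction_defs less image_iff less_Suc_eq_0_disj)
  have arcs: "(Inl (Suc 0), y) \<in> parcs H \<longleftrightarrow> y = Inl 0"
    "(Inl 0, y) \<in> parcs H \<longleftrightarrow> y = Inl (Suc 0) \<or> y = Inr 0"
    "(Inr 0, y) \<in> parcs H \<longleftrightarrow> y = Inl 0 \<or> y \<in> ?k ` {..<r}"
    "i < r \<Longrightarrow> (Inr (Suc i), y) \<in> parcs H \<longleftrightarrow> y = Inr 0 \<or> y \<in> ?k ` ({..<r} - {i})" for i y
    by (auto simp: H_def construction_defs image_iff less_Suc_eq_0_disj less_2_cases_iff)
  have mem: "Inl (Suc 0) \<in> pverts H" "Inl 0 \<in> pverts H" "Inr 0 \<in> pverts H"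
    "\<And>i. i < r \<Longrightarrow> Inr (Suc i) \<in> pverts H"
    by (simp_all add: verts)
  show ?thesis
    unfolding H_def[symmetric]
  proof
    assume "isomorphic G H"
    then obtain g where g: "bij_betw g (pverts H) (pverts G)"
      and adj: "\<And>x y. x \<in> pverts H \<Longrightarrow> y \<in> pverts H \<Longrightarrow> (x, y) \<in> parcs H \<longleftrightarrow> g y \<in> N (g x)"
      unfolding isomorphic_iff[OF wf] by blast
    define p q c h where "p = g (Inl (Suc 0))" and "q = g (Inl 0)" and "c = g (Inr 0)"
      and "h = (\<lambda>i. g (?k i))"
    note defs = p_def q_def c_def h_def
    have img: "pverts G = g ` pverts H"
      and ginj: "\<And>x y. x \<in> pverts H \<Longrightarrow> y \<in> pverts H \<Longrightarrow> g x = g y \<longleftrightarrow> x = y"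
      using g by (auto simp: bij_betw_def inj_on_eq_iff)
    have injh: "inj_on h {..<r}" and dist: "distinct [p, q, c]" "h ` {..<r} \<inter> {p, q, c} = {}"
      by (auto simp: inj_on_def defs ginj mem)
    have V: "pverts G = {p, q, c} \<union> h ` {..<r}"
      by (simp add: img verts defs image_image)
    have "{y \<in> pverts H. (Inl (Suc 0), y) \<in> parcs H} = {Inl 0}"
      by (auto simp: arcs mem)
    then have "N p = {q}"
      using N_image[OF g adj mem(1)] by (simp add: defs)
    moreover have "{y \<in> pverts H. (Inl 0, y) \<in> parcs H} = {Inl (Suc 0), Inr 0}"
      by (auto simp: arcs mem)
    then have "N q = {p, c}"
      using N_image[OF g adj mem(2)] by (simp add: defs)
    moreover have "{y \<in> pverts H. (Inr 0, y) \<in> parcs H} = insert (Inl 0) (?k ` {..<r})"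
      by (auto simp: arcs mem)
    then have "N c = insert q (h ` {..<r})"
      using N_image[OF g adj mem(3)] by (simp add: defs image_image)
    moreover have "N u = insert c (h ` {..<r} - {u})" if "u \<in> h ` {..<r}" for u
    proof -
      from that obtain i where i: "i \<in> {..<r}" "u = h i" by (rule imageE)
      have "{y \<in> pverts H. (?k i, y) \<in> parcs H} = insert (Inr 0) (?k ` ({..<r} - {i}))"
        using i(1) by (auto simp: arcs mem)
      then have "N u = insert c (h ` ({..<r} - {i}))"
        using N_image[OF g adj mem(4)[of i]] i by (simp add: defs image_image)
      also have "h ` ({..<r} - {i}) = h ` {..<r} - {u}"
        using inj_on_image_set_diff[OF injh, of "{..<r}" "{i}"] i by simp
      finally show ?thesis .
    qed
    moreover have "card (h ` {..<r}) = r" using card_image[OF injh] by simp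
    ultimately have "clique_with_tail c q p (h ` {..<r}) \<and> card (h ` {..<r}) = r"
      using V dist assms by (simp add: clique_with_tail_def)
    then show "\<exists>c q p K. clique_with_tail c q p K \<and> card K = r" by blast
  next
    assume "\<exists>c q p K. clique_with_tail c q p K \<and> card K = r"
    then obtain c q p K where *: "clique_with_tail c q p K" and r: "card K = r" by blast
    then have V: "pverts G = insert p (insert q (insert c K))"
      and ne: "c \<notin> K" "p \<notin> K" "q \<notin> K" "c \<noteq> p" "c \<noteq> q" "p \<noteq> q"
      and nbrs: "N c = insert q K" "N q = {p, c}" "N p = {q}" "\<And>u. u \<in> K \<Longrightarrow> N u = insert c (K - {u})"
      by (auto simp: clique_with_tail_def)
    have "finite K" using V pair_finite_verts by (auto intro: finite_subset)
    then obtain h where "bij_betw h {0..<r} K" using ex_bij_betw_nat_finite r by blast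
    then have h: "inj_on h {..<r}" "h ` {..<r} = K" by (auto simp: bij_betw_def lessThan_atLeast0)
    define g :: "nat + nat \<Rightarrow> 'a" where
      "g = case_sum (case_nat q (\<lambda>_. p)) (case_nat c h)"
    have gs: "g (Inl (Suc 0)) = p" "g (Inl 0) = q" "g (Inr 0) = c" "g (?k i) = h i" for i
      by (auto simp: g_def)
    have hK: "h i \<in> K" "h i \<noteq> c" "h i \<noteq> p" "h i \<noteq> q" if "i < r" for i using h(2) that ne by auto
    have hinj: "h i = h j \<longleftrightarrow> i = j" if "i < r" "j < r" for i j
      using h(1) that by (auto simp: inj_on_eq_iff)
    have "bij_betw g (pverts H) (pverts G)"
    proof (rule bij_betw_imageI)
      have "inj_on g (?k ` {..<r})" by (auto simp: inj_on_def gs hinj)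
      then show "inj_on g (pverts H)"
        unfolding verts using ne hK by (intro inj_on_insertI) (auto simp: gs)
      show "g ` pverts H = pverts G"
        by (simp add: verts V gs image_image h(2))
    qed
    moreover have "(x, y) \<in> parcs H \<longleftrightarrow> g y \<in> N (g x)" if xy: "x \<in> pverts H" "y \<in> pverts H" for x y
    proof -
      have y: "y = Inl (Suc 0) \<or> y = Inl 0 \<or> y = Inr 0 \<or> (\<exists>j<r. y = ?k j)" using xy verts by auto
      have "x = Inl (Suc 0) \<or> x = Inl 0 \<or> x = Inr 0 \<or> (\<exists>i<r. x = ?k i)" using xy verts by auto
      then show ?thesis
        using y by (elim disjE exE conjE)
          (use ne hK hinj in \<open>auto simp: arcs gs nbrs(1-3) nbrs(4)[OF hK(1)]\<close>)
    qed
    ultimately show "isomorphic G H" unfolding isomorphic_iff[OF wf] by blast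
  qed
qed

text \<open>For a windmill, \<open>{1..t}\<close> enumerates the classes \<open>cls a\<close> of mutually adjacent vertices of \<open>N c\<close>, and
  \<open>{0..<r i}\<close> enumerates the \<open>i\<close>-th class.\<close>

lemma isomorphic_windmill_iff:
  "(\<exists>t\<ge>2. \<exists>r :: nat \<Rightarrow> nat. (\<forall>i\<in>{1..t}. r i \<ge> 2) \<and>
      isomorphic G (graph_join (complete_graph 1)
        (indexed_disjoint_union {1..t} (\<lambda>i. complete_graph (r i)))))
    \<longleftrightarrow> (\<exists>c. windmill c)"
proof -
  define H where "H I r = graph_join (complete_graph 1)
    (indexed_disjoint_union I (\<lambda>i. complete_graph (r i)))" for I :: "nat set" and r :: "nat \<Rightarrow> nat"
  have wf: "parcs (H I r) \<subseteq> pverts (H I r) \<times> pverts (H I r)" for I r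
    by (auto simp: H_def construction_defs)
  have verts: "pverts (H I r) = insert (Inl 0) (Inr ` Sigma I (\<lambda>i. {..<r i}))" for I r
    by (auto simp: H_def construction_defs)
  have arcs: "(Inl 0, y) \<in> parcs (H I r) \<longleftrightarrow> y \<in> Inr ` Sigma I (\<lambda>i. {..<r i})"
    "(Inr a, Inl 0) \<in> parcs (H I r) \<longleftrightarrow> a \<in> Sigma I (\<lambda>i. {..<r i})"
    "i \<in> I \<Longrightarrow> j < r i \<Longrightarrow> (Inr (i, j), Inr (i', j')) \<in> parcs (H I r) \<longleftrightarrow> i' = i \<and> j' < r i \<and> j' \<noteq> j"
    for I r i j i' j' y a
    by (auto simp: H_def construction_defs)
  show ?thesis
    unfolding H_def[symmetric]
  proof
    assume "\<exists>t\<ge>2. \<exists>r. (\<forall>i\<in>{1..t}. 2 \<le> r i) \<and> isomorphic G (H {1..t} r)"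
    then obtain t r where t: "t \<ge> 2" and r0: "\<forall>i\<in>{1..t}. r i \<ge> 2"
      and iso0: "isomorphic G (H {1..t} r)" by blast
    define I where "I = {1..t}"
    have r: "\<And>i. i \<in> I \<Longrightarrow> r i \<ge> 2" and iso: "isomorphic G (H I r)" and I2: "1 \<in> I" "2 \<in> I"
      using r0 iso0 t by (auto simp: I_def)
    let ?I = "Sigma I (\<lambda>i. {..<r i})"
    obtain g where g: "bij_betw g (pverts (H I r)) (pverts G)"
      and adj: "\<And>x y. x \<in> pverts (H I r) \<Longrightarrow> y \<in> pverts (H I r) \<Longrightarrow> (x, y) \<in> parcs (H I r) \<longleftrightarrow> g y \<in> N (g x)"
      using iso unfolding isomorphic_iff[OF wf] by blast
    define c h where "c = g (Inl 0)" and "h = (\<lambda>a. g (Inr a))"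
    have img: "pverts G = g ` pverts (H I r)"
      and ginj: "\<And>x y. x \<in> pverts (H I r) \<Longrightarrow> y \<in> pverts (H I r) \<Longrightarrow> g x = g y \<longleftrightarrow> x = y"
      using g by (auto simp: bij_betw_def inj_on_eq_iff)
    have mem: "Inl 0 \<in> pverts (H I r)" "\<And>a. a \<in> ?I \<Longrightarrow> Inr a \<in> pverts (H I r)"
      unfolding verts by auto
    have ch: "c \<notin> h ` ?I" using ginj[OF mem(1) mem(2)] unfolding c_def h_def by blast
    have hinj: "h a = h b \<longleftrightarrow> a = b" if "a \<in> ?I" "b \<in> ?I" for a b
      using ginj[OF mem(2) mem(2)] that by (simp add: h_def)
    have V: "pverts G = insert c (h ` ?I)"
      by (simp add: img verts c_def h_def image_image)
    have "{y \<in> pverts (H I r). (Inl 0, y) \<in> parcs (H I r)} = Inr ` ?I"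
      unfolding verts arcs by blast
    then have Nc: "N c = h ` ?I"
      using N_image[OF g adj mem(1)] by (simp add: c_def h_def image_image)
    have Nh: "h (i', j') \<in> N (h (i, j)) \<longleftrightarrow> i' = i \<and> j' \<noteq> j" if "(i, j) \<in> ?I" "(i', j') \<in> ?I" for i j i' j'
      using adj[OF mem(2)[OF that(1)] mem(2)[OF that(2)]] that arcs(3)[of i I j r i' j']
      by (auto simp: h_def)
    show "\<exists>c. windmill c"
      unfolding windmill_def
    proof (intro exI conjI ballI impI)
      show "c \<in> pverts G" "N c = pverts G - {c}" using V Nc ch by auto
      fix a assume "a \<in> N c"
      then obtain i j where a: "(i, j) \<in> ?I" "a = h (i, j)" unfolding Nc by blast
      define j' where "j' = (if j = 0 then 1 else 0 :: nat)"
      have j': "(i, j') \<in> ?I" "j' \<noteq> j" using a(1) r[of i] by (auto simp: j'_def)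
      have "h (i, j') \<in> N a" using Nh[OF a(1) j'(1)] j'(2) a(2) by simp
      then show "N a \<inter> N c \<noteq> {}" using Nc j'(1) by blast
      fix b assume b: "b \<in> N a \<inter> N c"
      then obtain i1 j1 where b1: "(i1, j1) \<in> ?I" "b = h (i1, j1)" unfolding Nc by blast
      fix d assume d: "d \<in> N b \<inter> N c" "d \<noteq> a"
      then obtain i2 j2 where d2: "(i2, j2) \<in> ?I" "d = h (i2, j2)" unfolding Nc by blast
      have "i1 = i" using Nh[OF a(1) b1(1)] b a(2) b1(2) by simp
      moreover have "i2 = i1" using Nh[OF b1(1) d2(1)] d b1(2) d2(2) by simp
      ultimately have "i2 = i \<and> j2 \<noteq> j" using d(2) a(2) d2(2) by auto
      then show "d \<in> N a" using Nh[OF a(1) d2(1)] a(2) d2(2) by simp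
    next
      have m: "(1, 0) \<in> ?I" "(2, 0) \<in> ?I" using r[OF I2(1)] r[OF I2(2)] I2 by simp_all
      then have "h (1, 0) \<noteq> h (2, 0)" "h (2, 0) \<notin> N (h (1, 0))"
        using hinj[OF m] Nh[OF m] by simp_all
      then show "\<exists>a\<in>N c. \<exists>b\<in>N c. a \<noteq> b \<and> b \<notin> N a"
        unfolding Nc using m by blast
    qed
  next
    assume "\<exists>c. windmill c"
    then obtain c where W: "windmill c" by blast
    have c: "c \<in> pverts G" "N c = pverts G - {c}" and nbr: "\<And>a. a \<in> N c \<Longrightarrow> N a \<inter> N c \<noteq> {}"
      and trans: "\<And>a b d. a \<in> N c \<Longrightarrow> b \<in> N a \<inter> N c \<Longrightarrow> d \<in> N b \<inter> N c \<Longrightarrow> d \<noteq> a \<Longrightarrow> d \<in> N a"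
      and two: "\<exists>a\<in>N c. \<exists>b\<in>N c. a \<noteq> b \<and> b \<notin> N a"
      using W unfolding windmill_def by metis+
    have finN: "finite (N c)" using N_subset pair_finite_verts by (rule finite_subset)
    define cls where "cls a = insert a (N a \<inter> N c)" for a
    have cls_sub: "cls a \<subseteq> N c" if "a \<in> N c" for a using that by (auto simp: cls_def)
    have cls_sym: "a \<in> cls b" if "b \<in> cls a" "a \<in> N c" for a b
      using that N_sym[of a b] by (auto simp: cls_def)
    have cls_trans: "d \<in> cls a" if "a \<in> N c" "b \<in> cls a" "d \<in> cls b" for a b d
      using that trans[of a b d] by (auto simp: cls_def)
    have cls_eq: "cls b = cls a" if "a \<in> N c" "b \<in> cls a" for a b
    proof -
      have "b \<in> N c" using cls_sub that by blast
      then show ?thesis using cls_trans cls_sym that by blast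
    qed
    define Q where "Q = cls ` N c"
    have finQ: "finite Q" using finN by (simp add: Q_def)
    define t where "t = card Q"
    define I where "I = {1..t}"
    obtain e where "bij_betw e I Q"
      using ex_bij_betw_nat_finite_1[OF finQ] unfolding I_def t_def by blast
    then have e: "inj_on e I" "e ` I = Q" by (auto simp: bij_betw_def)
    define r where "r i = card (e i)" for i
    have eQ: "\<exists>a\<in>N c. e i = cls a" if "i \<in> I" for i using e(2) that unfolding Q_def by blast
    have fine: "finite (e i)" if "i \<in> I" for i
      using eQ[OF that] cls_sub finN finite_subset by metis
    have "\<exists>h. bij_betw h {0..<r i} (e i)" if "i \<in> I" for i
      unfolding r_def using ex_bij_betw_nat_finite[OF fine[OF that]] .
    then obtain h where h: "\<And>i. i \<in> I \<Longrightarrow> bij_betw (h i) {0..<r i} (e i)" by metis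
    let ?I = "Sigma I (\<lambda>i. {..<r i})"
    have hin: "h i j \<in> e i" if "i \<in> I" "j < r i" for i j
      using h[OF that(1)] that(2) by (auto simp: bij_betw_def)
    have hinj: "h i j = h i j' \<longleftrightarrow> j = j'" if "i \<in> I" "j < r i" "j' < r i" for i j j'
      using h[OF that(1)] that(2,3) by (auto simp: bij_betw_def inj_on_eq_iff)
    have e_cls: "e i = cls a" if "i \<in> I" "a \<in> e i" for i a
      using eQ[OF that(1)] cls_eq that(2) by metis
    have e_sub: "e i \<subseteq> N c" if "i \<in> I" for i using eQ[OF that] cls_sub by metis
    have same: "i' = i" if "i \<in> I" "i' \<in> I" "a \<in> e i" "a \<in> e i'" for i i' a
      using e_cls[OF that(1,3)] e_cls[OF that(2,4)] e(1) that(1,2) by (metis inj_onD)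
    have adj_h: "h i' j' \<in> N (h i j) \<longleftrightarrow> i' = i \<and> j' \<noteq> j"
      if "i \<in> I" "j < r i" "i' \<in> I" "j' < r i'" for i j i' j'
    proof -
      have ei: "e i = cls (h i j)" using e_cls hin that by simp
      have "h i' j' \<in> N c" using hin e_sub that by blast
      then have "h i' j' \<in> N (h i j) \<longleftrightarrow> h i' j' \<in> e i \<and> h i' j' \<noteq> h i j"
        unfolding ei cls_def by auto
      moreover have "h i' j' \<in> e i \<longleftrightarrow> i' = i" using same hin that by metis
      ultimately show ?thesis using hinj that by metis
    qed
    define H0 where "H0 = (\<lambda>(i, j). h i j)"
    have "H0 ` ?I = N c"
    proof
      show "H0 ` ?I \<subseteq> N c" using hin e_sub by (auto simp: H0_def)
      show "N c \<subseteq> H0 ` ?I"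
      proof
        fix a assume a: "a \<in> N c"
        then have "cls a \<in> e ` I" unfolding e(2) Q_def by blast
        then obtain i where i: "i \<in> I" "e i = cls a" by auto
        have "a \<in> h i ` {0..<r i}" using h[OF i(1)] i(2) by (auto simp: bij_betw_def cls_def)
        then obtain j where "j < r i" "a = H0 (i, j)" by (auto simp: H0_def)
        then show "a \<in> H0 ` ?I" using i(1) by blast
      qed
    qed
    moreover have "inj_on H0 ?I"
    proof (rule inj_onI)
      fix a b assume ab: "a \<in> ?I" "b \<in> ?I" "H0 a = H0 b"
      obtain i j i' j' where *: "a = (i, j)" "b = (i', j')" by fastforce
      then have m: "i \<in> I" "j < r i" "i' \<in> I" "j' < r i'" "h i j = h i' j'"
        using ab by (auto simp: H0_def)
      then have "i' = i" using same[of i i' "h i j"] hin[of i j] hin[of i' j'] by simp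
      then show "a = b" using hinj m * by simp
    qed
    ultimately have hbij: "inj_on H0 ?I" "H0 ` ?I = N c" by simp_all
    define g :: "nat + nat \<times> nat \<Rightarrow> 'a" where "g = case_sum (\<lambda>_. c) H0"
    have gs: "g (Inl 0) = c" "g (Inr a) = H0 a" for a by (auto simp: g_def)
    have "bij_betw g (pverts (H I r)) (pverts G)"
    proof (rule bij_betw_imageI)
      have "inj_on g (Inr ` ?I)" using hbij(1) by (auto simp: inj_on_def gs)
      moreover have img: "g ` Inr ` ?I = N c" using hbij(2) by (simp add: image_image gs)
      moreover have "c \<notin> g ` Inr ` ?I" unfolding img by simp
      ultimately show "inj_on g (pverts (H I r))"
        unfolding verts inj_on_insert using gs(1) by blast
      show "g ` pverts (H I r) = pverts G"
        unfolding verts image_insert img gs c(2) using c(1) by blast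
    qed
    moreover have "(x, y) \<in> parcs (H I r) \<longleftrightarrow> g y \<in> N (g x)"
      if xy: "x \<in> pverts (H I r)" "y \<in> pverts (H I r)" for x y
    proof -
      have hN: "h i j \<in> N c" "c \<in> N (h i j)" if "i \<in> I" "j < r i" for i j
      proof -
        show "h i j \<in> N c" using hin[OF that] e_sub[OF that(1)] by blast
        then show "c \<in> N (h i j)" using N_sym by simp
      qed
      have cases: "v = Inl 0 \<or> (\<exists>i\<in>I. \<exists>j<r i. v = Inr (i, j))" if "v \<in> pverts (H I r)" for v
        using that unfolding verts by blast
      consider "x = Inl 0" "y = Inl 0"
        | i j where "i \<in> I" "j < r i" "x = Inl 0" "y = Inr (i, j)"
        | i j where "i \<in> I" "j < r i" "x = Inr (i, j)" "y = Inl 0"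
        | i j i' j' where "i \<in> I" "j < r i" "i' \<in> I" "j' < r i'" "x = Inr (i, j)" "y = Inr (i', j')"
        using cases[OF xy(1)] cases[OF xy(2)] by blast
      then show ?thesis
      proof cases
        case 1
        then show ?thesis by (auto simp: gs arcs)
      next
        case 2
        then show ?thesis using hN by (auto simp: gs arcs H0_def)
      next
        case 3
        then show ?thesis using hN by (auto simp: gs arcs H0_def)
      next
        case (4 i j i' j')
        then show ?thesis using adj_h[OF 4(1-4)] 4(1,2) arcs(3)[of i I j r i' j'] by (auto simp: gs H0_def)
      qed
    qed
    ultimately have "isomorphic G (H I r)" unfolding isomorphic_iff[OF wf] by blast
    moreover have "\<forall>i\<in>I. r i \<ge> 2"
    proof
      fix i assume i: "i \<in> I"
      obtain a where a: "a \<in> N c" "e i = cls a" using eQ[OF i] by blast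
      obtain b where b: "b \<in> N a" "b \<in> N c" using nbr[OF a(1)] by auto
      have "{a, b} \<subseteq> e i" "a \<noteq> b" using a b by (auto simp: cls_def)
      then show "r i \<ge> 2" using card_mono[OF fine[OF i], of "{a, b}"] by (simp add: r_def)
    qed
    moreover have "t \<ge> 2"
    proof -
      obtain a b where ab: "a \<in> N c" "b \<in> N c" "a \<noteq> b" "b \<notin> N a" using two by blast
      then have "b \<in> cls b" "b \<notin> cls a" by (auto simp: cls_def)
      then have "cls a \<noteq> cls b" by blast
      then show ?thesis using card_mono[OF finQ, of "{cls a, cls b}"] ab by (simp add: t_def Q_def)
    qed
    ultimately show "\<exists>t\<ge>2. \<exists>r. (\<forall>i\<in>{1..t}. 2 \<le> r i) \<and> isomorphic G (H {1..t} r)"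
      unfolding I_def by blast
  qed
qed

end

section \<open>The extremal block-cacti\<close>

context universally_dominated_LD_set
begin

lemma S_nonempty: "S \<noteq> {}"
  using trace_nonempty[of w] by auto

lemma parts_disjoint:
  "S \<inter> X = {}" "S \<inter> Z = {}" "X \<inter> Z = {}" "w \<notin> S" "w \<notin> X" "w \<notin> Z"
  using w S_sub_Nw by (auto simp: X_def Z_def)

lemma pendant_neighborhood:
  assumes "z \<in> Z"
  shows "N z = T z"
proof -
  have "w \<notin> N z" using assms N_sym by (auto simp: Z_def)
  then have "N z \<subseteq> S"
    using N_subset[of z] Z_X_nonadjacent[OF assms] Z_independent[OF assms]
    unfolding verts_eq by blast
  then show ?thesis by auto
qed

text \<open>Under the hypothesis every clique of \<open>N w\<close> has a vertex in \<open>X\<close>, next to which no pendant may hang, so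
  \<open>Z\<close> is empty. As no trace on \<open>X\<close> is all of \<open>S\<close>, there are at least two cliques.\<close>

lemma windmill_if_every_clique_has_outside_vertex:
  assumes "\<forall>s\<in>S. N s \<inter> X \<noteq> {}"
  shows "windmill w"
proof -
  have "Z = {}"
  proof (rule ccontr)
    assume "Z \<noteq> {}"
    then obtain z where z: "z \<in> Z" by auto
    obtain s where s: "T z = {s}" using trace_Z_singleton[OF z] .
    then obtain x where "x \<in> X" "x \<in> N s" using assms by auto
    then show False using no_pendant_beside_X[of x s z] z s N_sym by auto
  qed
  then have "N w = pverts G - {w}" using w by (auto simp: verts_eq X_def S_sub_Nw[THEN subsetD])
  moreover have "N a \<inter> N w \<noteq> {}" if "a \<in> N w" for a
  proof (cases "a \<in> S")
    case True
    then show ?thesis using assms by (auto simp: X_def)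
  next
    case False
    then show ?thesis using trace_nonempty[of a] that S_sub_Nw by (auto simp: X_def)
  qed
  moreover have "d \<in> N a" if "a \<in> N w" "b \<in> N a \<inter> N w" "d \<in> N b \<inter> N w" "d \<noteq> a" for a b d
    using Nw_trans[of a b d] that by auto
  moreover have "\<exists>a\<in>N w. \<exists>b\<in>N w. a \<noteq> b \<and> b \<notin> N a"
  proof -
    obtain s where s: "s \<in> S" using S_nonempty by auto
    then obtain x where x: "x \<in> X" "x \<in> N s" using assms by auto
    then have sx: "s \<in> T x" using s N_sym by auto
    obtain s' where s': "s' \<in> S" "s' \<notin> T x" using trace_not_full[of x] x by auto
    have "s' \<notin> N s" using neighbors_in_S[OF x(1) sx] s' by auto
    moreover have "s \<in> N w" "s' \<in> N w" "s \<noteq> s'" using s s' sx S_sub_Nw by auto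
    ultimately show ?thesis by blast
  qed
  ultimately show ?thesis using w(1) unfolding windmill_def by blast
qed

text \<open>Here \<open>S\<close> and \<open>w\<close> form a clique, \<open>X\<close> is empty, and the rest of the graph consists of pendants at \<open>S\<close>.
  Two or more pendants are impossible: trading all vertices of \<open>S\<close> that carry a pendant for their
  pendants gives an LD-set of the complement.\<close>

lemma complete_or_pendant_if_clique:
  assumes s: "s \<in> S" "N s \<inter> X = {}" and clique: "S - {s} \<subseteq> N s"
  shows "(\<forall>v\<in>pverts G. N v = pverts G - {v}) \<or> (\<exists>c p K. clique_with_pendant c p K)"
proof -
  have sX: "s \<notin> T x" if "x \<in> X" for x using that s(2) N_sym by auto
  have SS: "N a \<inter> S = S - {a}" if "a \<in> S" for a
  proof -
    have "b \<in> N a" if "b \<in> S" "b \<noteq> a" for b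
    proof (cases "a = s \<or> b = s")
      case True
      then show ?thesis using clique that \<open>a \<in> S\<close> N_sym by auto
    next
      case False
      then show ?thesis
        using Nw_trans[of a s b] clique that \<open>a \<in> S\<close> s(1) S_sub_Nw N_sym by blast
    qed
    then show ?thesis by auto
  qed
  have "X = {}"
  proof (rule ccontr)
    assume "X \<noteq> {}"
    then obtain x where x: "x \<in> X" by auto
    then obtain t where t: "t \<in> T x" using trace_nonempty by blast
    then have "s \<noteq> t" using sX[OF x] by auto
    then have "s \<in> N t \<inter> S" using SS[of t] t s(1) by auto
    then show False using neighbors_in_S[OF x t] sX[OF x] by auto
  qed
  then have Nw: "N w = S" using S_sub_Nw by (auto simp: X_def)
  have V: "pverts G = insert w (S \<union> Z)" using verts_eq \<open>X = {}\<close> by simp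
  have NS: "N a = insert w (S - {a}) \<union> (N a \<inter> Z)" if "a \<in> S" for a
  proof -
    have "w \<in> N a" using that Nw N_sym by auto
    then show ?thesis using SS[OF that] N_subset[of a] V by blast
  qed
  show ?thesis
  proof (cases "Z = {}")
    case True
    then have "N v = pverts G - {v}" if "v \<in> pverts G" for v
      using that NS[of v] Nw V parts_disjoint by auto
    then show ?thesis by blast
  next
    case False
    then obtain z where z: "z \<in> Z" by auto
    obtain t where t: "T z = {t}" using trace_Z_singleton[OF z] .
    show ?thesis
    proof (cases "Z = {z}")
      case True
      let ?K = "insert w (S - {t})"
      have tS: "t \<in> S" using t by auto
      have "S \<noteq> {t}" using trace_not_full[of z] z t by auto
      then obtain t' where t': "t' \<in> S" "t' \<noteq> t" using tS by blast
      then have "card {w, t'} \<le> card ?K" using finite_S by (intro card_mono) auto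
      moreover have "w \<noteq> t'" using t'(1) parts_disjoint by blast
      ultimately have "card ?K \<ge> 2" by simp
      moreover have "N t \<inter> Z = {z}" using t True N_sym by auto
      then have "N t = insert z ?K" using NS[OF tS] by auto
      moreover have "N u = insert t (?K - {u})" if "u \<in> ?K" for u
      proof (cases "u = w")
        case True
        then show ?thesis using Nw tS parts_disjoint by auto
      next
        case False
        then have u: "u \<in> S" "u \<noteq> t" using that by auto
        then have "N u \<inter> Z = {}" using t True N_sym[of u z] \<open>Z = {z}\<close> by auto
        then show ?thesis using NS[OF u(1)] u tS parts_disjoint by auto
      qed
      ultimately have "clique_with_pendant t z ?K"
        unfolding clique_with_pendant_def using V True pendant_neighborhood[OF z] t tS z parts_disjoint by auto
      then show ?thesis by blast
    next
      case False
      then obtain z' where z': "z' \<in> Z" "z' \<noteq> z" using z by auto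
      define \<sigma> where "\<sigma> y = the_elem (T y)" for y
      have \<sigma>: "T y = {\<sigma> y}" if "y \<in> Z" for y
        using trace_Z_singleton[OF that] by (metis \<sigma>_def the_elem_eq)
      have inj: "inj_on \<sigma> Z" using \<sigma> trace_inj by (auto intro!: inj_onI)
      have \<sigma>S: "\<sigma> ` Z \<subseteq> S" using \<sigma> by blast
      define S' where "S' = (S - \<sigma> ` Z) \<union> Z"
      have finZ: "finite Z" using pair_finite_verts by (simp add: Z_def)
      have leaf: "N (\<sigma> y) \<inter> Z = {y}" if "y \<in> Z" for y
      proof -
        have "y \<in> N (\<sigma> y)" using \<sigma>[OF that] N_sym[of y "\<sigma> y"] by blast
        moreover have "y' = y" if y': "y' \<in> N (\<sigma> y)" "y' \<in> Z" for y'
        proof -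
          have "\<sigma> y \<in> S" using \<sigma>S \<open>y \<in> Z\<close> by auto
          then have "\<sigma> y \<in> T y'" using y' N_sym by auto
          then have "T y' = T y" using \<sigma>[OF y'(2)] \<sigma>[OF \<open>y \<in> Z\<close>] by auto
          then show ?thesis using trace_inj[of y' y] y' \<open>y \<in> Z\<close> by blast
        qed
        ultimately show ?thesis using that by blast
      qed
      have tr: "N (\<sigma> y) \<inter> S' = insert y (S - \<sigma> ` Z)" if "y \<in> Z" for y
      proof -
        have "N (\<sigma> y) \<inter> S = S - {\<sigma> y}" using SS \<sigma>S that by auto
        then show ?thesis using leaf[OF that] that unfolding S'_def by blast
      qed
      have wtr: "N w \<inter> S' = S - \<sigma> ` Z" using Nw parts_disjoint by (auto simp: S'_def)
      have False
      proof (rule exchange_impossible[of S' "insert w (\<sigma> ` Z)"])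
        show "S' \<subseteq> pverts G" using V by (auto simp: S'_def)
        have "card (\<sigma> ` Z) = card Z" using card_image[OF inj] .
        moreover have "card (S - \<sigma> ` Z) = card S - card (\<sigma> ` Z)"
          using finZ \<sigma>S by (intro card_Diff_subset) auto
        moreover have "card (\<sigma> ` Z) \<le> card S" using card_mono[OF finite_S \<sigma>S] .
        moreover have "card S' \<le> card (S - \<sigma> ` Z) + card Z" unfolding S'_def by (rule card_Un_le)
        ultimately show "card S' \<le> card S" by linarith
        show "pverts G - S' = insert w (\<sigma> ` Z)"
          using V \<sigma>S parts_disjoint by (auto simp: S'_def)
        have "inj_on (\<lambda>v. N v \<inter> S') (\<sigma> ` Z)"
        proof (rule inj_onI)
          fix u v assume uv: "u \<in> \<sigma> ` Z" "v \<in> \<sigma> ` Z" "N u \<inter> S' = N v \<inter> S'"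
          then obtain y y' where y: "y \<in> Z" "u = \<sigma> y" "y' \<in> Z" "v = \<sigma> y'" by auto
          then have "insert y (S - \<sigma> ` Z) = insert y' (S - \<sigma> ` Z)" using uv(3) tr by simp
          moreover have "y \<notin> S" "y' \<notin> S" using y parts_disjoint by auto
          ultimately have "y = y'" by blast
          then show "u = v" using y by simp
        qed
        moreover have "N v \<inter> S' \<noteq> N w \<inter> S'" if v: "v \<in> \<sigma> ` Z" for v
        proof -
          obtain y where y: "y \<in> Z" "v = \<sigma> y" using v by auto
          have "y \<in> N v \<inter> S'" using tr[OF y(1)] y(2) by simp
          moreover have "y \<notin> N w \<inter> S'" using wtr y(1) parts_disjoint by auto
          ultimately show ?thesis by blast
        qed
        ultimately show "inj_on (\<lambda>v. N v \<inter> S') (insert w (\<sigma> ` Z))" by (rule inj_on_insertI)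
        fix v assume v: "v \<in> insert w (\<sigma> ` Z)"
        show "\<not> S' \<subseteq> N v"
        proof
          assume full: "S' \<subseteq> N v"
          then have "Z \<subseteq> N v" by (auto simp: S'_def)
          moreover have "\<not> Z \<subseteq> N w" using z Nw parts_disjoint by auto
          ultimately obtain y where "y \<in> Z" "v = \<sigma> y" using v by auto
          then have "Z = {y}" using leaf[of y] \<open>Z \<subseteq> N v\<close> by blast
          then show False using z z' by auto
        qed
      qed
      then show ?thesis ..
    qed
  qed
qed

text \<open>The trace of \<open>x\<close> leaves only \<open>s\<close> for any other clique of \<open>N w\<close>. So \<open>x\<close> is the only vertex of \<open>X\<close>, and a
  pendant, which may not hang beside \<open>x\<close>, hangs at \<open>s\<close>.\<close>

lemma pendant_or_tail_if_trace_misses_one: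
  assumes s: "s \<in> S" "N s \<inter> X = {}" and one: "x \<in> X" "T x = S - {s}"
  shows "(\<exists>c p K. clique_with_pendant c p K) \<or> (\<exists>c q p K. clique_with_tail c q p K)"
proof -
  have sX: "s \<notin> T x" if "x \<in> X" for x using that s(2) N_sym by auto
  have xw: "x \<in> N w" "x \<notin> S" "x \<noteq> w" "x \<notin> Z" using one(1) parts_disjoint by (auto simp: X_def)
  have X_eq: "X = {x}"
  proof -
    have "y = x" if "y \<in> X" for y
    proof -
      obtain t where t: "t \<in> T y" using trace_nonempty \<open>y \<in> X\<close> by blast
      then have "t \<in> T x" using one sX[OF that] by auto
      then show ?thesis using X_trace_disjoint[OF that one(1) t] by simp
    qed
    then show ?thesis using one(1) by blast
  qed
  have trZ: "T z = {s}" if z: "z \<in> Z" for z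
  proof -
    obtain t where t: "T z = {t}" using trace_Z_singleton[OF z] .
    have "t \<notin> T x" using no_pendant_beside_X[OF one(1) _ z t] by blast
    then show ?thesis using t one(2) by auto
  qed
  let ?K = "insert x (S - {s})"
  obtain t where t: "t \<in> S - {s}" using one trace_nonempty[of x] by blast
  then have "card {x, t} \<le> card ?K" using finite_S by (intro card_mono) auto
  moreover have "x \<noteq> t" using t xw by blast
  ultimately have cardK: "card ?K \<ge> 2" by simp
  have Nw: "N w = insert s ?K" using S_sub_Nw s(1) X_eq by (auto simp: X_def)
  have wN: "w \<in> N v" if "v \<in> insert s ?K" for v using that Nw N_sym by auto
  have NS: "N a \<inter> S = S - {s} - {a}" if "a \<in> S - {s}" for a
    using neighbors_in_S[OF one(1), of a] one(2) that by auto
  have sS: "N s \<inter> S = {}"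
  proof -
    have "b \<notin> N s" if "b \<in> S" for b
      using NS[of b] that s(1) N_sym[of b s] by (cases "b = s") auto
    then show ?thesis by auto
  qed
  have NK: "N u = insert w (?K - {u})" if u: "u \<in> ?K" for u
  proof -
    have "y \<notin> N u" if y: "y \<in> Z" for y
    proof (cases "u = x")
      case True
      then show ?thesis using Z_X_nonadjacent[OF y one(1)] N_sym by auto
    next
      case False
      then have "u \<in> S" "u \<noteq> s" using u by auto
      then show ?thesis using trZ[OF y] N_sym[of y u] by blast
    qed
    then have "N u \<inter> Z = {}" by blast
    moreover have "N u \<inter> (S \<union> X) = ?K - {u}"
    proof (cases "u = x")
      case True
      then show ?thesis using one(2) X_eq xw by auto
    next
      case False
      then have us: "u \<in> S - {s}" using u by auto
      then have "x \<in> N u" using one(2) N_sym by auto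
      then show ?thesis using NS[OF us] X_eq False by auto
    qed
    ultimately show ?thesis using wN[of u] u N_subset[of u] unfolding verts_eq by blast
  qed
  have Ns: "N s = insert w (N s \<inter> Z)"
    using wN[of s] sS s(2) N_subset[of s] unfolding verts_eq by blast
  show ?thesis
  proof (cases "Z = {}")
    case True
    then have "clique_with_pendant w s ?K"
      unfolding clique_with_pendant_def
      using verts_eq X_eq s(1) parts_disjoint xw Ns Nw NK cardK by auto
    then show ?thesis by blast
  next
    case False
    then obtain z where z: "z \<in> Z" by auto
    have "Z = {z}" using trZ trace_inj z by auto
    moreover have "N s \<inter> Z = {z}" using trZ \<open>Z = {z}\<close> N_sym by auto
    ultimately have "clique_with_tail w s z ?K"
      unfolding clique_with_tail_def
      using verts_eq X_eq s(1) parts_disjoint xw Ns Nw NK cardK pendant_neighborhood[OF z] trZ[OF z] by auto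
    then show ?thesis by blast
  qed
qed

lemma extremal_structure:
  "(\<forall>v\<in>pverts G. N v = pverts G - {v}) \<or> (\<exists>c p K. clique_with_pendant c p K) \<or>
    (\<exists>c q p K. clique_with_tail c q p K) \<or> windmill w"
  using windmill_if_every_clique_has_outside_vertex complete_or_pendant_if_clique
    pendant_or_tail_if_trace_misses_one exchange_center by metis

end

theorem theorem4:
  fixes G :: "'a pair_pre_digraph"
  assumes "pair_graph G"
    and "block_cactus G"
    and "card (pverts G) \<ge> 2"
  shows "location_domination_number (complement G) = location_domination_number G + 1 \<longleftrightarrow>
    (\<exists>r\<ge>2. isomorphic G
        (graph_join (complete_graph 1) (disjoint_union (complete_graph 1) (complete_graph r)))) \<or>
    (\<exists>r\<ge>2. isomorphic G (join_by_edge (complete_graph 2) 0 (complete_graph (r + 1)) 0)) \<or>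
    (\<exists>r\<ge>1. isomorphic G (complete_graph (r + 1))) \<or>
    (\<exists>t\<ge>2. \<exists>r :: nat \<Rightarrow> nat. (\<forall>i\<in>{1..t}. r i \<ge> 2) \<and>
        isomorphic G (graph_join (complete_graph 1)
          (indexed_disjoint_union {1..t} (\<lambda>i. complete_graph (r i)))))"
proof -
  interpret G: block_cactus_graph G
    using assms(1,2) by (simp add: block_cactus_graph_def block_cactus_graph_axioms_def)
  let ?Eq = "location_domination_number (complement G) = location_domination_number G + 1"
  have K: "G.clique_with_pendant c p K \<Longrightarrow> card K \<ge> 2"
    "G.clique_with_tail c q p K \<Longrightarrow> card K \<ge> 2" for c q p K
    by (simp_all add: G.clique_with_pendant_def G.clique_with_tail_def)
  have a: "(\<exists>r\<ge>2. isomorphic G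
        (graph_join (complete_graph 1) (disjoint_union (complete_graph 1) (complete_graph r))))
      \<longleftrightarrow> (\<exists>c p K. G.clique_with_pendant c p K)"
    using G.isomorphic_clique_with_pendant_iff K by blast
  have b: "(\<exists>r\<ge>2. isomorphic G (join_by_edge (complete_graph 2) 0 (complete_graph (r + 1)) 0))
      \<longleftrightarrow> (\<exists>c q p K. G.clique_with_tail c q p K)"
    using G.isomorphic_clique_with_tail_iff K by blast
  have "card (pverts G) = (card (pverts G) - 1) + 1" "card (pverts G) - 1 \<ge> 1" using assms(3) by auto
  then have c: "(\<exists>r\<ge>1. isomorphic G (complete_graph (r + 1)))
      \<longleftrightarrow> (\<forall>v\<in>pverts G. G.N v = pverts G - {v})"
    unfolding G.isomorphic_complete_graph_iff by metis
  have "?Eq \<longleftrightarrow> (\<exists>c p K. G.clique_with_pendant c p K) \<or> (\<exists>c q p K. G.clique_with_tail c q p K) \<or>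
    (\<forall>v\<in>pverts G. G.N v = pverts G - {v}) \<or> (\<exists>c. G.windmill c)"
  proof
    assume eq: ?Eq
    obtain S where S: "LD_set G S" "card S = location_domination_number G"
      using minimum_LD_set[OF G.pair_finite_verts] .
    have larger: "card S < card S'" if "LD_set (complement G) S'" for S'
      using location_domination_number_le[of "complement G" S'] that eq S(2) G.pair_finite_verts by simp
    have "\<not> LD_set (complement G) S" using larger by blast
    then obtain w where w: "w \<in> pverts G" "w \<notin> S" "S \<subseteq> G.N w"
      using S(1) by (auto simp: G.LD_set_complement_iff G.LD_set_iff)
    interpret universally_dominated_LD_set G S w
      using S(1) w larger by unfold_locales auto
    show "(\<exists>c p K. G.clique_with_pendant c p K) \<or> (\<exists>c q p K. G.clique_with_tail c q p K) \<or>
      (\<forall>v\<in>pverts G. G.N v = pverts G - {v}) \<or> (\<exists>c. G.windmill c)"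
      using extremal_structure by blast
  next
    assume "(\<exists>c p K. G.clique_with_pendant c p K) \<or> (\<exists>c q p K. G.clique_with_tail c q p K) \<or>
      (\<forall>v\<in>pverts G. G.N v = pverts G - {v}) \<or> (\<exists>c. G.windmill c)"
    then show ?Eq
      using G.clique_with_pendant_number G.clique_with_tail_number G.complete_number[OF assms(3)]
        G.windmill_number by blast
  qed
  then show ?thesis
    unfolding a b c G.isomorphic_windmill_iff by blast
qed

end
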